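(* Let $R$ be a strong preparation map and let $M=M^\circ R:T\to T$ be the associated linear map. The adjoint $M^*$ is a good multi-pre-Lie morphism on $T$, that is, $$M^*(\sigma\curvearrowright_a\tau)=(M^*\sigma)\curvearrowright_a(M^*\tau)\qquad\text{and}\qquad M^*\!\uparrow^k\;=\;\uparrow^k\! M^*$$ for all $\sigma,\tau\in T$, $k\in\mathbb{N}^{d+1}$ and $a\in\mathfrak{T}^+\times\mathbb{N}^{d+1}$, and it satisfies $M^*(\zeta_l)=R^*(\zeta_l)$ for all $1\leq l\leq n_0$.
   Context: **Decorated trees.** Fix integers $d,n_0,k_0\ge 1$, a finite set of noise types $\mathfrak{T}^-=\{\mathfrak{t}^-_1,\dots,\mathfrak{t}^-_{n_0}\}$ and a finite set of operator types $\mathfrak{T}^+=\{\mathfrak{t}_1^+,\dots,\mathfrak{t}_{k_0}^+\}$. Decorated trees are non-planar rooted trees with a decoration $\mathfrak{n}_v\in\mathbb{N}^{d+1}$ at each node $v$, each edge being decorated by an element $(\mathfrak{t},p)$ of $\mathfrak{T}^+\times\mathbb{N}^{d+1}$, and with at most one noise attached to each node. A noise of type $\mathfrak{t}_l^-$ attached to a node (an edge of noise type leading directly to a leaf) is denoted by the symbol $\zeta_l$, $1\le l\le n_0$; the leaf of a noise edge is not counted as a node of the tree. By convention $\zeta_0=\mathbf{1}$ (no noise). Write $N_\tau$ for the node set of $\tau$. For $a\in\mathfrak{T}^+\times\mathbb{N}^{d+1}$, $\mathcal{I}_a(\tau)$ is the tree obtained by grafting $\tau$ onto a new undecorated root via an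 edge decorated by $a$; $X^k$ is the single node decorated by $k$; $X^0=\mathbf{1}$. Every decorated tree has a unique decomposition (up to reordering) $\tau=X^k\zeta_l\prod_{j=1}^n\mathcal{I}_{a_j}(\tau_j)$ with $0\le l\le n_0$, $a_j\in\mathfrak{T}^+\times\mathbb{N}^{d+1}$, the product being the tree product (identification of roots). $T$ is the real linear span of all decorated trees. **Inner product.** Grouping equal factors, $\tau=X^k\zeta_l\prod_{j=1}^m\mathcal{I}_{a_j}(\tau_j)^{\beta_j}$ with $(a_i,\tau_i)\ne(a_j,\tau_j)$ for $i\neq j$, set inductively $S(\tau)=k!\prod_{j=1}^mS(\tau_j)^{\beta_j}\beta_j!$. The inner product on $T$ is $\langle\sigma,\tau\rangle:=S(\tau)\mathbf{1}_{\sigma=\tau}$ on trees, and $\langle\sigma_1\otimes\sigma_2,\tau_1\otimes\tau_2\rangle:=\langle\sigma_1,\tau_1\rangle\langle\sigma_2,\tau_2\rangle$. The adjoint $A^*:T\to T$ of a linear map $A:T\to T$ is characterised by $\langle A^*\sigma,\tau\rangle=\langle\sigma,A\tau\rangle$ for all $\sigma,\tau\in T$; $R$ is assumed to have an adjoint $R^*:T\to T$. **Degree and $T_+$.** Fix a scaling $\mathfrak{s}\in\mathbb{N}^{d+1}$ with positive entries and a map $|\cdot|_{\mathfrak{s}}:\mathfrak{T}^-\cup\mathfrak{T}^+\to\mathbb{R}$ negative on $\mathfrak{T}^-$ and positive on $\mathfrak{T}^+$; set $|p|_{\mathfrak s}=\sum_i\mathfrak{s}_ip_i$. The degree $\deg(\tau)$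 is the sum of $|\mathfrak{n}_v|_{\mathfrak{s}}$ over nodes $v$, of $|\mathfrak{t}|_{\mathfrak s}-|p|_{\mathfrak s}$ over edges decorated by $(\mathfrak{t},p)$, and of $|\mathfrak{t}_l^-|_{\mathfrak s}$ over the noises $\zeta_l$ ($l\ge1$) of $\tau$. $|\tau|$ is the number of noise symbols $\zeta_l$, $l\ge1$, in $\tau$. $T_+$ is the linear span of trees $X^k\prod_{i=1}^n\mathcal{I}_{a_i}(\tau_i)$ with $\deg(\mathcal{I}_{a_i}(\tau_i))>0$ for all $i$. **Grafting products and $\star$.** For $a=(\mathfrak{t},p)$ and $m\in\mathbb{N}^{d+1}$ write $a-m=(\mathfrak{t},p-m)$; a tree having an edge decoration $(\mathfrak{t},p-m)$ with $p-m\notin\mathbb{N}^{d+1}$ is set to $0$. For decorated trees $\sigma_1,\dots,\sigma_n,\tau$ and $a_i\in\mathfrak{T}^+\times\mathbb{N}^{d+1}$, $$\prod_{i=1}^n\mathcal{I}_{a_i}(\sigma_i)\curvearrowright\tau:=\sum_{v_1,\dots,v_n\in N_\tau}\ \sum_{m_1,\dots,m_n\in\mathbb{N}^{d+1}}\ \prod_{v\in N_\tau}\frac{\mathfrak{n}_v!}{\big(\mathfrak{n}_v-\sum_{i:v_i=v}m_i\big)!\prod_{i:v_i=v}m_i!}\ \tau_{v,m},$$ where $\tau_{v,m}$ is obtained from $\tau$ by replacing the decoration $\mathfrak{n}_v$ of each node $v$ of $\tau$ by $\mathfrak{n}_v-\sum_{i:v_i=v}m_i$ and grafting each $\sigma_i$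 onto the node $v_i$ with an edge decorated by $a_i-m_i$ (terms with $\sum_{i:v_i=v}m_i\not\le\mathfrak{n}_v$ for some $v$ are zero). For a single tree, $\sigma\curvearrowright_a\tau:=\mathcal{I}_a(\sigma)\curvearrowright\tau$, extended bilinearly. For $B\subset N_\tau$, $\uparrow_B^k:=\prod_{r=1}^{d+1}\big(\sum_{v\in B}\uparrow_v^{e_r}\big)^{k_r}$, where $\uparrow_v^{e_r}$ adds $e_r$ to the decoration at $v$ and $(e_r)$ is the canonical basis of $\mathbb{N}^{d+1}$; $\uparrow^k\tau:=\uparrow^k_{N_\tau}\tau$ on trees, extended linearly. For $\sigma=X^k\prod_i\mathcal{I}_{a_i}(\sigma_i)$ with $a_i\in\mathfrak{T}^+\times\mathbb{N}^{d+1}$, $$\sigma\star\tau:=\ \uparrow^k_{N_\tau}\Big(\prod_i\mathcal{I}_{a_i}(\sigma_i)\curvearrowright\tau\Big),$$ where $\uparrow^k_{N_\tau}$ acts only on the nodes coming from $\tau$; extended bilinearly. $\Delta:T\to T\otimes T_+$ is the linear map characterised by $\langle\sigma\star\tau,\mu\rangle=\langle\tau\otimes\sigma,\Delta\mu\rangle$ for all $\sigma\in T_+$, $\tau,\mu\in T$. **Strong preparation maps.** A preparation map is a linear map $R:T\to T$ such that (i) for each decorated tree $\tau$ there are finitely many trees $\tau_i$ and constants $\lambda_i$ with $R\tau=\tau+\sum_i\lambda_i\tau_i$, $\deg(\tau_i)\ge\deg(\tau)$ and $|\tau_i|<|\tau|$; (ii) $(R\otimes\mathrm{id})\Delta=\Delta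 R$. It is strong if moreover $R^*(\sigma\star\tau)=\sigma\star(R^*\tau)$ for all $\tau\in T$ and all $\sigma=X^k\prod_i\mathcal{I}_{a_i}(\sigma_i)\in T$ with $a_i\in\mathfrak{T}^+\times\mathbb{N}^{d+1}$ (with no condition on degrees). **The maps $M^\circ$ and $M$.** Given $R$, $M^\circ:T\to T$ is the linear map, multiplicative for the tree product, with $M^\circ\mathbf{1}=\mathbf{1}$, $M^\circ X^k=X^k$, $M^\circ\zeta_l=\zeta_l$, and $M^\circ(\mathcal{I}_a(\tau))=\mathcal{I}_a(M^\circ(R\tau))$ for all $\tau\in T$, $a\in\mathfrak{T}^+\times\mathbb{N}^{d+1}$; that is, $M^\circ\big(X^k\zeta_l\prod_j\mathcal{I}_{a_j}(\tau_j)\big)=X^k\zeta_l\prod_j\mathcal{I}_{a_j}(M^\circ R\tau_j)$ (a well-founded recursion, since $R-\mathrm{Id}$ strictly decreases the number of noises). Then $M:=M^\circ R$. *)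

theory Defs
  imports "HOL-Analysis.Analysis" "HOL-Analysis.Finite_Function_Topology"
begin

section \<open>Decorated trees\<close>

text \<open>
  Type parameters: \<open>'n\<close> is the finite set of noise types, \<open>'k\<close> the finite set of operator types,
  and \<open>'i\<close> indexes the \<open>d + 1\<close> coordinates, so that \<open>nat ^ 'i\<close> is the set of multi-indices.
  The second component of a node is its noise; \<open>None\<close> is the convention \<open>\<zeta>\<^sub>0 = 1\<close>. A noise is thus
  not an edge of this datatype and its leaf is not a node. The multiset of branches makes the
  trees non-planar.
\<close>

type_synonym ('k, 'i) edge = "'k \<times> (nat ^ 'i)"

datatype ('n, 'k, 'i) dtree =
  Node "nat ^ 'i" "'n option" "(('k \<times> (nat ^ 'i)) \<times> ('n, 'k, 'i) dtree) multiset"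

text \<open>The real span of a set of symbols: finitely supported real functions.\<close>

type_synonym ('n, 'k, 'i) T = "('n, 'k, 'i) dtree \<Rightarrow>\<^sub>0 real"
type_synonym ('n, 'k, 'i) TT = "(('n, 'k, 'i) dtree \<times> ('n, 'k, 'i) dtree) \<Rightarrow>\<^sub>0 real"

definition basis :: "'a \<Rightarrow> ('a \<Rightarrow>\<^sub>0 real)" where
  "basis x = Poly_Mapping.single x 1"

definition lin_ext :: "('a \<Rightarrow> 'b::real_vector) \<Rightarrow> ('a \<Rightarrow>\<^sub>0 real) \<Rightarrow> 'b" where
  "lin_ext f x = (\<Sum>t\<in>Poly_Mapping.keys x. Poly_Mapping.lookup x t *\<^sub>R f t)"

lemma lookup_scaleR: "Poly_Mapping.lookup (c *\<^sub>R x) t = c *\<^sub>R Poly_Mapping.lookup (x :: 'a \<Rightarrow>\<^sub>0 real) t"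
proof -
  have "finite {i. c *\<^sub>R Poly_Mapping.lookup x i \<noteq> 0}"
    by (rule finite_subset[OF _ finite_keys[of x]]) (auto simp: in_keys_iff)
  then show ?thesis by (simp add: scaleR_poly_mapping_def)
qed

lemma lin_ext_superset:
  assumes "finite A" "Poly_Mapping.keys x \<subseteq> A"
  shows "lin_ext f x = (\<Sum>t\<in>A. Poly_Mapping.lookup x t *\<^sub>R f t)"
  unfolding lin_ext_def by (rule sum.mono_neutral_left) (use assms in \<open>auto simp: in_keys_iff\<close>)

lemma linear_lin_ext:
  fixes f :: "'a \<Rightarrow> 'b::real_vector"
  shows "linear (lin_ext f)"
proof (rule linearI)
  fix x y :: "'a \<Rightarrow>\<^sub>0 real"
  let ?A = "Poly_Mapping.keys x \<union> Poly_Mapping.keys y"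
  show "lin_ext f (x + y) = lin_ext f x + lin_ext f y"
    by (simp add: lin_ext_superset[of ?A] keys_add lookup_add scaleR_add_left sum.distrib)
next
  fix c :: real and x :: "'a \<Rightarrow>\<^sub>0 real"
  have "Poly_Mapping.keys (c *\<^sub>R x) \<subseteq> Poly_Mapping.keys x"
    by (auto simp: in_keys_iff lookup_scaleR)
  then show "lin_ext f (c *\<^sub>R x) = c *\<^sub>R lin_ext f x"
    by (simp add: lin_ext_superset[of "Poly_Mapping.keys x"] lookup_scaleR scaleR_sum_right)
qed

lemma lin_ext_basis [simp]: "lin_ext f (basis t) = f t"
  by (simp add: lin_ext_def basis_def)

lemma lin_ext_lin_ext: "lin_ext f (lin_ext g x) = lin_ext (\<lambda>t. lin_ext f (g t)) x"
  unfolding lin_ext_def[of g]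
  by (simp add: linear_sum[OF linear_lin_ext] linear_cmul[OF linear_lin_ext] lin_ext_def[of _ x])

definition bilin_ext ::
    "('a \<Rightarrow> 'b \<Rightarrow> 'c::real_vector) \<Rightarrow> ('a \<Rightarrow>\<^sub>0 real) \<Rightarrow> ('b \<Rightarrow>\<^sub>0 real) \<Rightarrow> 'c" where
  "bilin_ext f x y = lin_ext (\<lambda>s. lin_ext (f s) y) x"

definition tensor :: "('a \<Rightarrow>\<^sub>0 real) \<Rightarrow> ('b \<Rightarrow>\<^sub>0 real) \<Rightarrow> (('a \<times> 'b) \<Rightarrow>\<^sub>0 real)" where
  "tensor = bilin_ext (\<lambda>s t. basis (s, t))"

definition tensor_map_id ::
    "(('a \<Rightarrow>\<^sub>0 real) \<Rightarrow> ('c \<Rightarrow>\<^sub>0 real)) \<Rightarrow> (('a \<times> 'b) \<Rightarrow>\<^sub>0 real) \<Rightarrow> (('c \<times> 'b) \<Rightarrow>\<^sub>0 real)" where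
  "tensor_map_id A = lin_ext (\<lambda>(s, t). tensor (A (basis s)) (basis t))"

definition X :: "nat ^ 'i \<Rightarrow> ('n, 'k, 'i::finite) dtree" where
  "X k = Node k None {#}"

definition \<zeta> :: "'n \<Rightarrow> ('n, 'k, 'i::finite) dtree" where
  "\<zeta> l = Node 0 (Some l) {#}"

definition \<I> :: "('k, 'i) edge \<Rightarrow> ('n, 'k, 'i::finite) dtree \<Rightarrow> ('n, 'k, 'i) dtree" where
  "\<I> a \<tau> = Node 0 None {#(a, \<tau>)#}"

abbreviation \<I>T :: "('k, 'i) edge \<Rightarrow> ('n, 'k, 'i::finite) T \<Rightarrow> ('n, 'k, 'i) T" where
  "\<I>T a \<equiv> lin_ext (\<lambda>\<tau>. basis (\<I> a \<tau>))"

fun root_noise :: "('n, 'k, 'i::finite) dtree \<Rightarrow> 'n option" where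
  "root_noise (Node k l E) = l"

text \<open>
  The tree product identifies roots. It is undefined if both roots carry a noise (a node has at
  most one noise); the value \<open>0\<close> used in that case plays no role below.
\<close>

fun tree_prod ::
    "('n, 'k, 'i::finite) dtree \<Rightarrow> ('n, 'k, 'i) dtree \<Rightarrow> ('n, 'k, 'i) T" where
  "tree_prod (Node k None E) (Node k' l' E') = basis (Node (k + k') l' (E + E'))"
| "tree_prod (Node k (Some l) E) (Node k' None E') = basis (Node (k + k') (Some l) (E + E'))"
| "tree_prod (Node k (Some l) E) (Node k' (Some l') E') = 0"

definition prodT ::
    "('n, 'k, 'i::finite) T \<Rightarrow> ('n, 'k, 'i) T \<Rightarrow> ('n, 'k, 'i) T" where
  "prodT = bilin_ext tree_prod"


section \<open>Symmetry factor, inner products and adjoints\<close>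

definition mfact :: "nat ^ 'i::finite \<Rightarrow> real" where
  "mfact k = (\<Prod>r\<in>UNIV. fact (k $ r))"

lemma size_branch_less:
  "(a, \<tau>) \<in># E \<Longrightarrow> size \<tau> < size (Node k l (E :: (('k \<times> (nat ^ 'i)) \<times> ('n, 'k, 'i::finite) dtree) multiset))"
  by (auto dest!: multi_member_split)

function S :: "('n, 'k, 'i::finite) dtree \<Rightarrow> real" where
  "S (Node k l E) =
     mfact k * (\<Prod>(a, \<tau>)\<in>set_mset E. S \<tau> ^ count E (a, \<tau>) * fact (count E (a, \<tau>)))"
  by pat_completeness auto
termination
  by (relation "Wellfounded.measure size") (auto simp: size_branch_less simp del: dtree.size)

definition inner_T :: "('n, 'k, 'i::finite) T \<Rightarrow> ('n, 'k, 'i) T \<Rightarrow> real" where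
  "inner_T = bilin_ext (\<lambda>\<sigma> \<tau>. if \<sigma> = \<tau> then S \<tau> else 0)"

definition inner_TT :: "('n, 'k, 'i::finite) TT \<Rightarrow> ('n, 'k, 'i) TT \<Rightarrow> real" where
  "inner_TT = bilin_ext (\<lambda>(\<sigma>1, \<sigma>2) (\<tau>1, \<tau>2).
     inner_T (basis \<sigma>1) (basis \<tau>1) * inner_T (basis \<sigma>2) (basis \<tau>2))"

definition is_adjoint ::
    "(('n, 'k, 'i::finite) T \<Rightarrow> ('n, 'k, 'i) T) \<Rightarrow> (('n, 'k, 'i) T \<Rightarrow> ('n, 'k, 'i) T) \<Rightarrow> bool" where
  "is_adjoint A B \<longleftrightarrow> linear B \<and> (\<forall>\<sigma> \<tau>. inner_T (B \<sigma>) \<tau> = inner_T \<sigma> (A \<tau>))"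

text \<open>Unique if it exists, since \<open>inner_T\<close> is nondegenerate; existence is not automatic.\<close>

definition adj ::
    "(('n, 'k, 'i::finite) T \<Rightarrow> ('n, 'k, 'i) T) \<Rightarrow> (('n, 'k, 'i) T \<Rightarrow> ('n, 'k, 'i) T)" where
  "adj A = (THE B. is_adjoint A B)"


section \<open>Degree\<close>

definition sdeg :: "nat ^ 'i::finite \<Rightarrow> nat ^ 'i \<Rightarrow> real" where
  "sdeg s p = (\<Sum>r\<in>UNIV. real (s $ r) * real (p $ r))"

text \<open>
  In the following, \<open>s\<close> is the scaling and \<open>dn\<close>, \<open>dk\<close> are the restrictions of the map
  \<open>|\<cdot>|\<^sub>s\<close> to the noise types and to the operator types.
\<close>

function deg ::
    "nat ^ 'i::finite \<Rightarrow> ('n \<Rightarrow> real) \<Rightarrow> ('k \<Rightarrow> real) \<Rightarrow> ('n, 'k, 'i) dtree \<Rightarrow> real" where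
  "deg s dn dk (Node k l E) =
     sdeg s k + (case l of None \<Rightarrow> 0 | Some l' \<Rightarrow> dn l')
     + (\<Sum>(a, \<tau>)\<in>#E. dk (fst a) - sdeg s (snd a) + deg s dn dk \<tau>)"
  by pat_completeness auto
termination
  by (relation "Wellfounded.measure (\<lambda>(s, dn, dk, \<tau>). size \<tau>)") (auto simp: size_branch_less simp del: dtree.size)

function noise_count :: "('n, 'k, 'i::finite) dtree \<Rightarrow> nat" where
  "noise_count (Node k l E) =
     (if l = None then 0 else 1) + (\<Sum>(a, \<tau>)\<in>#E. noise_count \<tau>)"
  by pat_completeness auto
termination
  by (relation "Wellfounded.measure size") (auto simp: size_branch_less simp del: dtree.size)

definition Tplus ::
    "nat ^ 'i::finite \<Rightarrow> ('n \<Rightarrow> real) \<Rightarrow> ('k \<Rightarrow> real) \<Rightarrow> ('n, 'k, 'i) T set" where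
  "Tplus s dn dk =
     span {basis (Node k None E) |k E. \<forall>(a, \<tau>)\<in>#E. deg s dn dk (\<I> a \<tau>) > 0}"


section \<open>Nodes of a tree\<close>

text \<open>
  The nodes of a non-planar tree have no canonical names. They are named here through a planar
  representative: a node is the list of child indices leading to it from the root. \<open>planar \<tau>\<close> fixes
  one representative of \<open>\<tau>\<close>; the sums over nodes below do not depend on this choice, because
  their values are mapped back by \<open>forget\<close>.
\<close>

datatype ('n, 'k, 'i) ptree =
  PNode "nat ^ 'i" "'n option" "(('k \<times> (nat ^ 'i)) \<times> ('n, 'k, 'i) ptree) list"

primrec forget :: "('n, 'k, 'i::finite) ptree \<Rightarrow> ('n, 'k, 'i) dtree" where
  "forget (PNode k l es) = Node k l (mset (map (map_prod id forget) es))"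

definition planar :: "('n, 'k, 'i::finite) dtree \<Rightarrow> ('n, 'k, 'i) ptree" where
  "planar \<tau> = (SOME p. forget p = \<tau>)"

lemma forget_planar: "forget (planar \<tau>) = \<tau>"
proof -
  have "\<exists>p. forget p = \<tau>"
  proof (induction \<tau>)
    case (Node k l E)
    have "\<exists>es. mset (map (map_prod id forget) es) = E" using Node
    proof (induction E)
      case (add x E)
      obtain a t where x: "x = (a,t)" by (cases x)
      from add.prems[of x t] x obtain p where p: "forget p = t" by auto
      obtain es where "mset (map (map_prod id forget) es) = E" using add by (metis insert_iff set_mset_add_mset_insert)
      then have "mset (map (map_prod id forget) ((a,p)#es)) = add_mset x E" using x p by simp
      then show ?case by blast
    qed auto
    then show ?case by (metis forget.simps)
  qed
  then show ?thesis unfolding planar_def by (rule someI_ex)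
qed

fun node_dec_opt :: "('n, 'k, 'i::finite) ptree \<Rightarrow> nat list \<Rightarrow> (nat ^ 'i) option" where
  "node_dec_opt (PNode k l es) [] = Some k"
| "node_dec_opt (PNode k l es) (j # v) =
     (if j < length es then node_dec_opt (snd (es ! j)) v else None)"

definition nodes :: "('n, 'k, 'i::finite) ptree \<Rightarrow> nat list set" where
  "nodes p = {v. node_dec_opt p v \<noteq> None}"

definition node_dec :: "('n, 'k, 'i::finite) ptree \<Rightarrow> nat list \<Rightarrow> nat ^ 'i" where
  "node_dec p v = the (node_dec_opt p v)"

text \<open>\<open>modify f v p\<close> applies \<open>f\<close> to the subtree of \<open>p\<close> at the node \<open>v\<close>.\<close>

fun modify ::
    "(('n, 'k, 'i::finite) ptree \<Rightarrow> ('n, 'k, 'i) ptree) \<Rightarrow> nat list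
     \<Rightarrow> ('n, 'k, 'i) ptree \<Rightarrow> ('n, 'k, 'i) ptree" where
  "modify f [] p = f p"
| "modify f (j # v) (PNode k l es) =
     PNode k l (if j < length es then es[j := map_prod id (modify f v) (es ! j)] else es)"


section \<open>Grafting\<close>

text \<open>
  \<open>graft_step v m (a, \<sigma>)\<close> lowers the decoration of \<open>v\<close> by \<open>m\<close> and grafts \<open>\<sigma>\<close> onto \<open>v\<close> along an edge
  decorated by \<open>a - m\<close>. New branches are appended on the right, so that the names of the existing
  nodes are preserved; hence the nodes of \<open>p\<close> keep their names in \<open>graft_at fs v m p\<close>, which is the
  tree \<open>\<tau>\<^bsub>v,m\<^esub>\<close>.
\<close>

definition graft_step ::
    "nat list \<Rightarrow> nat ^ 'i::finite \<Rightarrow> ('k, 'i) edge \<times> ('n, 'k, 'i) ptree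
     \<Rightarrow> ('n, 'k, 'i) ptree \<Rightarrow> ('n, 'k, 'i) ptree" where
  "graft_step v m = (\<lambda>((t, p), \<sigma>).
     modify (\<lambda>q. case q of PNode k l es \<Rightarrow> PNode (k - m) l (es @ [((t, p - m), \<sigma>)])) v)"

definition graft_at ::
    "(('k, 'i::finite) edge \<times> ('n, 'k, 'i) ptree) list \<Rightarrow> (nat \<Rightarrow> nat list) \<Rightarrow> (nat \<Rightarrow> nat ^ 'i)
     \<Rightarrow> ('n, 'k, 'i) ptree \<Rightarrow> ('n, 'k, 'i) ptree" where
  "graft_at fs v m p = fold (\<lambda>i. graft_step (v i) (m i) (fs ! i)) [0..<length fs] p"

definition graft_coeff ::
    "nat \<Rightarrow> (nat \<Rightarrow> nat list) \<Rightarrow> (nat \<Rightarrow> nat ^ 'i::finite) \<Rightarrow> ('n, 'k, 'i) ptree \<Rightarrow> real" where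
  "graft_coeff n v m p =
     (\<Prod>u\<in>nodes p. mfact (node_dec p u) /
        (mfact (node_dec p u - (\<Sum>i | i < n \<and> v i = u. m i)) * (\<Prod>i | i < n \<and> v i = u. mfact (m i))))"

definition pgraft ::
    "(('k, 'i::finite) edge \<times> ('n, 'k, 'i) ptree) list \<Rightarrow> ('n, 'k, 'i) ptree
     \<Rightarrow> (('n, 'k, 'i) ptree \<Rightarrow>\<^sub>0 real)" where
  "pgraft fs p =
     (let n = length fs in
      \<Sum>v \<in> {..<n} \<rightarrow>\<^sub>E nodes p.
      \<Sum>m \<in> {m \<in> {..<n} \<rightarrow>\<^sub>E UNIV. \<forall>u\<in>nodes p. (\<Sum>i | i < n \<and> v i = u. m i) \<le> node_dec p u}.
        graft_coeff n v m p *\<^sub>R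
        (if \<forall>i<n. m i \<le> snd (fst (fs ! i)) then basis (graft_at fs v m p) else 0))"

abbreviation planar_branches ::
    "(('k, 'i::finite) edge \<times> ('n, 'k, 'i) dtree) list \<Rightarrow> (('k, 'i) edge \<times> ('n, 'k, 'i) ptree) list" where
  "planar_branches \<equiv> map (map_prod id planar)"

abbreviation forget_lin :: "(('n, 'k, 'i::finite) ptree \<Rightarrow>\<^sub>0 real) \<Rightarrow> ('n, 'k, 'i) T" where
  "forget_lin \<equiv> lin_ext (\<lambda>p. basis (forget p))"

definition graft ::
    "(('k, 'i::finite) edge \<times> ('n, 'k, 'i) dtree) list \<Rightarrow> ('n, 'k, 'i) dtree \<Rightarrow> ('n, 'k, 'i) T" where
  "graft fs \<tau> = forget_lin (pgraft (planar_branches fs) (planar \<tau>))"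

definition graft1 ::
    "('n, 'k, 'i::finite) T \<Rightarrow> ('k, 'i) edge \<Rightarrow> ('n, 'k, 'i) T \<Rightarrow> ('n, 'k, 'i) T"
    ("_ \<curvearrowright>\<^bsub>_\<^esub> _" [66, 0, 67] 66) where
  "\<sigma> \<curvearrowright>\<^bsub>a\<^esub> \<tau> = bilin_ext (\<lambda>\<sigma>' \<tau>'. graft [(a, \<sigma>')] \<tau>') \<sigma> \<tau>"


section \<open>Raising decorations\<close>

definition up_node ::
    "'i \<Rightarrow> nat list \<Rightarrow> ('n, 'k, 'i::finite) ptree \<Rightarrow> ('n, 'k, 'i) ptree" where
  "up_node r = modify (\<lambda>q. case q of PNode k l es \<Rightarrow> PNode (k + axis r 1) l es)"

definition up_dir ::
    "nat list set \<Rightarrow> 'i \<Rightarrow> (('n, 'k, 'i::finite) ptree \<Rightarrow>\<^sub>0 real) \<Rightarrow> (('n, 'k, 'i) ptree \<Rightarrow>\<^sub>0 real)" where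
  "up_dir B r x = (\<Sum>v\<in>B. lin_ext (\<lambda>p. basis (up_node r v p)) x)"

lemma up_node_commute:
  fixes p :: "('n, 'k, 'i::finite) ptree"
  shows "up_node r v (up_node r' w p) = up_node r' w (up_node r v p)"
proof (induction v arbitrary: w p)
  case Nil
  show ?case
    by (cases w; cases p) (simp_all add: up_node_def ac_simps)
next
  case (Cons j v)
  show ?case
  proof (cases w)
    case Nil
    then show ?thesis by (cases p) (simp add: up_node_def)
  next
    case (Cons i w')
    have *: "modify (\<lambda>q. case q of PNode k l es \<Rightarrow> PNode (k + axis r 1) l es) v
        (modify (\<lambda>q. case q of PNode k l es \<Rightarrow> PNode (k + axis r' 1) l es) w' q)
      = modify (\<lambda>q. case q of PNode k l es \<Rightarrow> PNode (k + axis r' 1) l es) w'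
        (modify (\<lambda>q. case q of PNode k l es \<Rightarrow> PNode (k + axis r 1) l es) v q)" for q :: "('n, 'k, 'i) ptree"
      using Cons.IH[of w' q] by (simp add: up_node_def)
    show ?thesis
    proof (cases "i = j")
      case True
      then show ?thesis using Cons
        by (cases p) (auto simp: up_node_def * map_prod_def split: prod.splits simp del: One_nat_def)
    next
      case False
      then show ?thesis using Cons
        by (cases p) (auto simp: up_node_def list_update_swap)
    qed
  qed
qed

lemma up_dir_commute: "up_dir B r (up_dir B r' x) = up_dir B r' (up_dir B r x)"
proof -
  have *: "up_dir B r (up_dir B r' x)
      = (\<Sum>v\<in>B. \<Sum>w\<in>B. lin_ext (\<lambda>p. basis (up_node r v (up_node r' w p))) x)" for r r'
    unfolding up_dir_def
    by (simp only: linear_sum[OF linear_lin_ext] lin_ext_lin_ext lin_ext_basis)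
  show ?thesis
    unfolding *[of r r'] *[of r' r] by (subst sum.swap) (simp only: up_node_commute[of r _ r'])
qed

lemma up_dir_funpow_commute:
  "(up_dir B r ^^ m) ((up_dir B r' ^^ n) x) = (up_dir B r' ^^ n) ((up_dir B r ^^ m) x)"
proof -
  have *: "up_dir B r ((up_dir B r' ^^ n) y) = (up_dir B r' ^^ n) (up_dir B r y)" for y
    by (induction n) (simp_all add: up_dir_commute[of B r r'])
  show ?thesis
    by (induction m) (simp_all add: *)
qed

lemma comp_fun_commute_up_dir:
  "comp_fun_commute (\<lambda>r F. (up_dir B r ^^ (k $ r)) \<circ> F)"
  by unfold_locales (simp add: fun_eq_iff up_dir_funpow_commute)

text \<open>
  The composition over the coordinates \<open>r\<close> of the commuting operators \<open>up_dir B r ^^ (k $ r)\<close>;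
  the order of composition is irrelevant by \<open>comp_fun_commute_up_dir\<close>.
\<close>

definition up_on ::
    "nat list set \<Rightarrow> nat ^ 'i::finite
     \<Rightarrow> (('n, 'k, 'i) ptree \<Rightarrow>\<^sub>0 real) \<Rightarrow> (('n, 'k, 'i) ptree \<Rightarrow>\<^sub>0 real)" where
  "up_on B k = Finite_Set.fold (\<lambda>r F. (up_dir B r ^^ (k $ r)) \<circ> F) id UNIV"

definition up :: "nat ^ 'i::finite \<Rightarrow> ('n, 'k, 'i) T \<Rightarrow> ('n, 'k, 'i) T" where
  "up k = lin_ext (\<lambda>\<tau>. forget_lin (up_on (nodes (planar \<tau>)) k (basis (planar \<tau>))))"


section \<open>The product \<open>\<star>\<close> and the coproduct\<close>

text \<open>
  The left factor of \<open>\<star>\<close> ranges over the span of the trees without noise at the root; on other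
  trees the extension is by \<open>0\<close> and is never used. The list \<open>fs\<close> is any enumeration of the branches.
\<close>

fun star_tree :: "('n, 'k, 'i::finite) dtree \<Rightarrow> ('n, 'k, 'i) dtree \<Rightarrow> ('n, 'k, 'i) T" where
  "star_tree (Node k None E) \<tau> =
     (let fs = (SOME fs. mset fs = E)
      in forget_lin (up_on (nodes (planar \<tau>)) k (pgraft (planar_branches fs) (planar \<tau>))))"
| "star_tree (Node k (Some l) E) \<tau> = 0"

definition star :: "('n, 'k, 'i::finite) T \<Rightarrow> ('n, 'k, 'i) T \<Rightarrow> ('n, 'k, 'i) T"
    (infixl "\<star>" 65) where
  "star = bilin_ext star_tree"

definition is_coproduct ::
    "nat ^ 'i::finite \<Rightarrow> ('n \<Rightarrow> real) \<Rightarrow> ('k \<Rightarrow> real)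
     \<Rightarrow> (('n, 'k, 'i) T \<Rightarrow> ('n, 'k, 'i) TT) \<Rightarrow> bool" where
  "is_coproduct s dn dk D \<longleftrightarrow>
     linear D \<and>
     (\<forall>\<mu>. D \<mu> \<in> span {tensor \<tau> \<sigma> |\<tau> \<sigma>. \<sigma> \<in> Tplus s dn dk}) \<and>
     (\<forall>\<sigma>\<in>Tplus s dn dk. \<forall>\<tau> \<mu>. inner_T (\<sigma> \<star> \<tau>) \<mu> = inner_TT (tensor \<tau> \<sigma>) (D \<mu>))"

text \<open>
  Uniqueness follows from \<open>S > 0\<close>. Existence: for a tree \<open>\<mu>\<close>, only finitely many pairs of trees
  \<open>(\<tau>, \<sigma>)\<close> with \<open>\<sigma>\<close> in \<open>Tplus\<close> have \<open>inner_T (\<sigma> \<star> \<tau>) \<mu> \<noteq> 0\<close>, as the positivity of the degrees of the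
  branches of \<open>\<sigma>\<close> bounds the decorations of the grafted edges, and all else is bounded by \<open>\<mu>\<close>.
\<close>

definition Delta ::
    "nat ^ 'i::finite \<Rightarrow> ('n \<Rightarrow> real) \<Rightarrow> ('k \<Rightarrow> real) \<Rightarrow> ('n, 'k, 'i) T \<Rightarrow> ('n, 'k, 'i) TT" where
  "Delta s dn dk = (THE D. is_coproduct s dn dk D)"


section \<open>Preparation maps\<close>

definition preparation_map ::
    "nat ^ 'i::finite \<Rightarrow> ('n \<Rightarrow> real) \<Rightarrow> ('k \<Rightarrow> real)
     \<Rightarrow> (('n, 'k, 'i) T \<Rightarrow> ('n, 'k, 'i) T) \<Rightarrow> bool" where
  "preparation_map s dn dk R \<longleftrightarrow>
     linear R \<and>
     (\<forall>\<tau>. \<exists>A c. finite A \<and>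
        (\<forall>\<tau>'\<in>A. deg s dn dk \<tau>' \<ge> deg s dn dk \<tau> \<and> noise_count \<tau>' < noise_count \<tau>) \<and>
        R (basis \<tau>) = basis \<tau> + (\<Sum>\<tau>'\<in>A. c \<tau>' *\<^sub>R basis \<tau>')) \<and>
     tensor_map_id R \<circ> Delta s dn dk = Delta s dn dk \<circ> R"

definition strong_preparation_map ::
    "nat ^ 'i::finite \<Rightarrow> ('n \<Rightarrow> real) \<Rightarrow> ('k \<Rightarrow> real)
     \<Rightarrow> (('n, 'k, 'i) T \<Rightarrow> ('n, 'k, 'i) T) \<Rightarrow> bool" where
  "strong_preparation_map s dn dk R \<longleftrightarrow>
     preparation_map s dn dk R \<and>
     (\<exists>B. is_adjoint R B) \<and>
     (\<forall>\<sigma> \<tau>. root_noise \<sigma> = None \<longrightarrow> adj R (basis \<sigma> \<star> \<tau>) = basis \<sigma> \<star> adj R \<tau>)"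


section \<open>The maps \<open>M\<degree>\<close> and \<open>M\<close>\<close>

definition is_Mcirc ::
    "(('n, 'k, 'i::finite) T \<Rightarrow> ('n, 'k, 'i) T) \<Rightarrow> (('n, 'k, 'i) T \<Rightarrow> ('n, 'k, 'i) T) \<Rightarrow> bool" where
  "is_Mcirc R F \<longleftrightarrow>
     linear F \<and>
     (\<forall>\<sigma> \<tau>. root_noise \<sigma> = None \<or> root_noise \<tau> = None \<longrightarrow>
        F (prodT (basis \<sigma>) (basis \<tau>)) = prodT (F (basis \<sigma>)) (F (basis \<tau>))) \<and>
     (\<forall>k. F (basis (X k)) = basis (X k)) \<and>
     (\<forall>l. F (basis (\<zeta> l)) = basis (\<zeta> l)) \<and>
     (\<forall>a \<tau>. F (\<I>T a \<tau>) = \<I>T a (F (R \<tau>)))"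

text \<open>Existence and uniqueness hold whenever \<open>R - id\<close> lowers the number of noises.\<close>

definition Mcirc ::
    "(('n, 'k, 'i::finite) T \<Rightarrow> ('n, 'k, 'i) T) \<Rightarrow> (('n, 'k, 'i) T \<Rightarrow> ('n, 'k, 'i) T)" where
  "Mcirc R = (THE F. is_Mcirc R F)"

definition M ::
    "(('n, 'k, 'i::finite) T \<Rightarrow> ('n, 'k, 'i) T) \<Rightarrow> (('n, 'k, 'i) T \<Rightarrow> ('n, 'k, 'i) T)" where
  "M R = Mcirc R \<circ> R"

definition good_multi_pre_Lie_morphism ::
    "(('n, 'k, 'i::finite) T \<Rightarrow> ('n, 'k, 'i) T) \<Rightarrow> bool" where
  "good_multi_pre_Lie_morphism F \<longleftrightarrow>
     linear F \<and>
     (\<forall>\<sigma> \<tau> a. F (\<sigma> \<curvearrowright>\<^bsub>a\<^esub> \<tau>) = F \<sigma> \<curvearrowright>\<^bsub>a\<^esub> F \<tau>) \<and>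
     (\<forall>k. F \<circ> up k = up k \<circ> F)"

end

theory Submission
  imports Defs
begin

text \<open>
  Write \<open>N = (M\<degree>)\<^sup>*\<close>, so that \<open>M\<^sup>* = R\<^sup>* N\<close>. It is given by the structural recursion
  \<open>N (X\<^sup>k \<zeta>\<^sub>l \<Prod>\<^sub>j \<I>\<^sub>a\<^sub>j(\<tau>\<^sub>j)) = X\<^sup>k \<zeta>\<^sub>l \<Prod>\<^sub>j \<I>\<^sub>a\<^sub>j(R\<^sup>* N \<tau>\<^sub>j)\<close>, which also shows that the adjoint
  exists. Taking \<open>\<sigma> = \<I>\<^sub>a(\<sigma>')\<close> and \<open>\<sigma> = X\<^sup>k\<close> in the definition of a strong preparation map, \<open>R\<^sup>*\<close>
  commutes with \<open>\<sigma>' \<curvearrowright>\<^sub>a\<close> and with \<open>\<up>\<^sup>k\<close>. It remains to see that \<open>N (\<sigma> \<curvearrowright>\<^sub>a \<tau>) = (M\<^sup>* \<sigma>) \<curvearrowright>\<^sub>a (N \<tau>)\<close> and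
  \<open>N \<up>\<^sup>k = \<up>\<^sup>k N\<close>. Grafting and raising in one direction act on a tree by a change at the root plus
  the sum of their actions on the branches, so this follows by induction on \<open>\<tau>\<close>.
\<close>

section \<open>Linear extension\<close>

lemma poly_mapping_linear_induct [case_names add scaleR basis]:
  fixes x :: "'a \<Rightarrow>\<^sub>0 real"
  assumes add: "\<And>x y. P x \<Longrightarrow> P y \<Longrightarrow> P (x + y)"
    and scaleR: "\<And>c x. P x \<Longrightarrow> P (c *\<^sub>R x)"
    and basis: "\<And>t. P (basis t)"
  shows "P x"
proof -
  have zero: "P 0" using scaleR[OF basis, of 0] by simp
  have "P (\<Sum>t\<in>A. c t *\<^sub>R basis t)" if "finite A" for A and c :: "'a \<Rightarrow> real"
    using that by induction (auto intro: zero add scaleR basis)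
  moreover have "x = (\<Sum>t\<in>Poly_Mapping.keys x. Poly_Mapping.lookup x t *\<^sub>R basis t)"
    by (rule poly_mapping_eqI)
      (auto simp: lookup_sum lookup_scaleR basis_def lookup_single when_def in_keys_iff
        if_distrib sum.delta cong: if_cong)
  ultimately show ?thesis by (metis finite_keys)
qed

lemma lookup_basis: "Poly_Mapping.lookup (basis s) t = (if s = t then 1 else 0)"
  by (simp add: basis_def lookup_single when_def)

lemmas lin_ext_linear [simp] =
  linear_add[OF linear_lin_ext] linear_cmul[OF linear_lin_ext] linear_0[OF linear_lin_ext]

lemma linear_eqI_basis:
  assumes "linear f" "linear g" "\<And>t. f (basis t) = g (basis t)"
  shows "f x = g x"
  by (induction x rule: poly_mapping_linear_induct)
    (simp_all add: assms(3) linear_add[OF assms(1)] linear_add[OF assms(2)]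
      linear_cmul[OF assms(1)] linear_cmul[OF assms(2)])

lemma linear_eq_lin_ext: "linear f \<Longrightarrow> f = lin_ext (\<lambda>t. f (basis t))"
  by (rule ext, rule linear_eqI_basis) (auto simp: linear_lin_ext)

text \<open>As a congruence rule for recursive definitions it restricts the calls under
  \<open>lin_ext\<close> to the trees in the support, on which the termination of
  \<open>Mcirc_tree\<close> relies.\<close>

lemma lin_ext_cong [fundef_cong]:
  "\<lbrakk>x = y; \<And>t. t \<in> Poly_Mapping.keys y \<Longrightarrow> f t = g t\<rbrakk> \<Longrightarrow> lin_ext f x = lin_ext g y"
  by (simp add: lin_ext_def)

lemma bilin_ext_linear [simp]:
  "bilin_ext f (x + x') y = bilin_ext f x y + bilin_ext f x' y"
  "bilin_ext f (c *\<^sub>R x) y = c *\<^sub>R bilin_ext f x y"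
  "bilin_ext f 0 y = 0"
  "bilin_ext f x (y + y') = bilin_ext f x y + bilin_ext f x y'"
  "bilin_ext f x (c *\<^sub>R y) = c *\<^sub>R bilin_ext f x y"
  "bilin_ext f x 0 = 0"
  "bilin_ext f (basis s) (basis t) = f s t"
  by (simp_all add: bilin_ext_def)
    (simp_all add: lin_ext_def sum.distrib scaleR_add_right scaleR_sum_right mult.left_commute)

text \<open>Bookkeeping for the Leibniz rules: in a sum over the choice of one distinguished factor,
  a new element is either distinguished itself or stays in the rest.\<close>

lemma sum_mset_add_mset_diff:
  "(\<Sum>y\<in>#add_mset x E. f y (add_mset x E - {#y#}))
    = f x E + (\<Sum>y\<in>#E. f y (add_mset x (E - {#y#})))"
proof -
  have "(\<Sum>y\<in>#E. f y (add_mset x E - {#y#})) = (\<Sum>y\<in>#E. f y (add_mset x (E - {#y#})))"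
    by (rule arg_cong[where f = sum_mset], rule image_mset_cong) simp
  then show ?thesis by simp
qed

lemma linear_sum_mset:
  assumes "linear f"
  shows "f (\<Sum>y\<in>#E. g y) = (\<Sum>y\<in>#E. f (g y))"
  by (induction E) (simp_all add: linear_0[OF assms] linear_add[OF assms])

section \<open>Attaching branches at the root\<close>

text \<open>The tree product with the planted tree \<open>\<I> a \<sigma>\<close> (see
  \<open>prodT_IT\<close>). A planted tree has no noise at its root, so the exceptional case of
  \<open>tree_prod\<close> does not arise.\<close>

definition attach ::
    "('k, 'i::finite) edge \<Rightarrow> ('n, 'k, 'i) T \<Rightarrow> ('n, 'k, 'i) T \<Rightarrow> ('n, 'k, 'i) T" where
  "attach a = bilin_ext (\<lambda>\<sigma> \<tau>. case \<tau> of Node k l E \<Rightarrow> basis (Node k l (add_mset (a, \<sigma>) E)))"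

lemma attach_linear [simp]:
  "attach a (x + x') A = attach a x A + attach a x' A"
  "attach a (c *\<^sub>R x) A = c *\<^sub>R attach a x A"
  "attach a 0 A = 0"
  "attach a x (A + A') = attach a x A + attach a x A'"
  "attach a x (c *\<^sub>R A) = c *\<^sub>R attach a x A"
  "attach a x 0 = 0"
  "attach a (basis \<sigma>) (basis (Node k l E)) = basis (Node k l (add_mset (a, \<sigma>) E))"
  by (simp_all add: attach_def)

lemma linear_attach: "linear (attach a x)"
  by (rule linearI) simp_all

lemma linear_attach_left: "linear (\<lambda>x. attach a x A)"
  by (rule linearI) simp_all

lemma attach_commute: "attach a x (attach b y A) = attach b y (attach a x A)"
proof (induction A rule: poly_mapping_linear_induct)
  case (basis \<tau>)
  show ?case
  proof (induction x rule: poly_mapping_linear_induct)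
    case (basis \<sigma>)
    show ?case
      by (induction y rule: poly_mapping_linear_induct) (cases \<tau>, simp_all add: add_mset_commute)+
  qed simp_all
qed simp_all

text \<open>With a bare root for \<open>A\<close>, the tree whose branches have been transformed by
  \<open>G\<close>. Both \<open>M\<degree>\<close> and its adjoint have this shape, for different
  \<open>G\<close>. The order of the fold is immaterial by \<open>attach_commute\<close>.\<close>

definition attach_all ::
    "(('n, 'k, 'i::finite) dtree \<Rightarrow> ('n, 'k, 'i) T)
     \<Rightarrow> (('k, 'i) edge \<times> ('n, 'k, 'i) dtree) multiset \<Rightarrow> ('n, 'k, 'i) T \<Rightarrow> ('n, 'k, 'i) T" where
  "attach_all G E A = fold_mset (\<lambda>(a, \<tau>). attach a (G \<tau>)) A E"

lemma attach_all_empty [simp]: "attach_all G {#} A = A"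
  by (simp add: attach_all_def)

lemma attach_all_add_mset [simp]:
  "attach_all G (add_mset (a, \<tau>) E) A = attach a (G \<tau>) (attach_all G E A)"
proof -
  interpret comp_fun_commute "\<lambda>(a, \<tau>). attach a (G \<tau>)"
    by unfold_locales (auto simp: fun_eq_iff attach_commute)
  show ?thesis by (simp add: attach_all_def)
qed

text \<open>Through this congruence rule, recursive calls inside \<open>G\<close> are known to
  concern branches in \<open>E\<close>.\<close>

lemma attach_all_cong [fundef_cong]:
  assumes "E = E'" "A = A'" "\<And>a \<tau>. (a, \<tau>) \<in># E' \<Longrightarrow> G \<tau> = G' \<tau>"
  shows "attach_all G E A = attach_all G' E' A'"
proof -
  have "attach_all G E' A' = attach_all G' E' A'"
    using assms(3)
    by (induction E')
      (simp, metis (no_types) attach_all_add_mset prod.exhaust insertCI set_mset_add_mset_insert)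
  then show ?thesis using assms by simp
qed

lemma attach_all_basis:
  "attach_all basis E (basis (Node k l F)) = basis (Node k l (E + F))"
  by (induction E) auto

lemma linear_attach_all: "linear (attach_all G E)"
proof (induction E)
  case empty
  then show ?case by (simp add: linear_iff)
next
  case (add y E)
  then show ?case by (cases y) (simp add: linear_iff)
qed

lemma attach_all_attach: "attach_all G E (attach a x A) = attach a x (attach_all G E A)"
  by (induction E) (auto simp: attach_commute)

section \<open>Derivations\<close>

text \<open>The common form of grafting one tree and of raising in one direction: the action hits
  one node at a time, and \<open>\<rho> k l\<close> is its effect on a node with decoration
  \<open>k\<close> and noise \<open>l\<close>, taken without its branches.\<close>

function branch_deriv ::
    "(nat ^ 'i::finite \<Rightarrow> 'n option \<Rightarrow> ('n, 'k, 'i) T) \<Rightarrow> ('n, 'k, 'i) dtree \<Rightarrow> ('n, 'k, 'i) T" where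
  "branch_deriv \<rho> (Node k l E) = attach_all basis E (\<rho> k l)
     + (\<Sum>(a, \<tau>)\<in>#E. attach a (branch_deriv \<rho> \<tau>) (basis (Node k l (E - {#(a, \<tau>)#}))))"
  by pat_completeness auto
termination
  by (relation "Wellfounded.measure (\<lambda>(\<rho>, \<tau>). size \<tau>)")
    (auto simp: size_branch_less simp del: dtree.size)

declare branch_deriv.simps [simp del]

text \<open>A Leibniz rule. As \<open>\<rho>\<close> does not see the branches, the action at the
  root passes through a newly attached one; every other term acts either in that branch or in an old
  one.\<close>

lemma branch_deriv_attach:
  "lin_ext (branch_deriv \<rho>) (attach b x A)
    = attach b (lin_ext (branch_deriv \<rho>) x) A + attach b x (lin_ext (branch_deriv \<rho>) A)"
proof (induction x rule: poly_mapping_linear_induct)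
  case (basis \<sigma>)
  show ?case
  proof (induction A rule: poly_mapping_linear_induct)
    case (basis \<tau>)
    obtain k l E where \<tau>: "\<tau> = Node k l E" by (cases \<tau>)
    let ?f = "\<lambda>y F. attach (fst y) (branch_deriv \<rho> (snd y)) (basis (Node k l F))"
    have "(\<Sum>y\<in>#E. ?f y (add_mset (b, \<sigma>) (E - {#y#})))
        = attach b (basis \<sigma>) (\<Sum>y\<in>#E. ?f y (E - {#y#}))"
      by (simp add: linear_sum_mset[OF linear_attach] attach_commute[of b]
          flip: attach_linear(7))
    then show ?case
      using sum_mset_add_mset_diff[of ?f "(b, \<sigma>)" E]
      by (simp add: \<tau> branch_deriv.simps case_prod_unfold)
  qed (simp_all add: algebra_simps)
qed (simp_all add: algebra_simps)

lemma branch_deriv_attach_all: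
  "lin_ext (branch_deriv \<rho>) (attach_all G E A) = attach_all G E (lin_ext (branch_deriv \<rho>) A)
    + (\<Sum>(a, \<tau>)\<in>#E. attach a (lin_ext (branch_deriv \<rho>) (G \<tau>)) (attach_all G (E - {#(a, \<tau>)#}) A))"
proof (induction E)
  case (add y E)
  obtain b \<sigma> where y: "y = (b, \<sigma>)" by (cases y)
  let ?f = "\<lambda>y F. attach (fst y) (lin_ext (branch_deriv \<rho>) (G (snd y))) (attach_all G F A)"
  have "(\<Sum>y\<in>#E. ?f y (add_mset (b, \<sigma>) (E - {#y#})))
      = attach b (G \<sigma>) (\<Sum>y\<in>#E. ?f y (E - {#y#}))"
    by (simp add: linear_sum_mset[OF linear_attach] attach_commute[of b])
  then show ?case
    using add sum_mset_add_mset_diff[of ?f "(b, \<sigma>)" E]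
    by (simp add: y branch_deriv_attach case_prod_unfold)
qed simp

section \<open>Planar representatives\<close>

lemma nodes_PNode:
  "nodes (PNode k l es) = insert [] (\<Union>j<length es. (#) j ` nodes (snd (es ! j)))"
proof -
  have "v \<in> nodes (PNode k l es)
      \<longleftrightarrow> v \<in> insert [] (\<Union>j<length es. (#) j ` nodes (snd (es ! j)))" for v
    by (cases v) (auto simp: nodes_def split: if_splits)
  then show ?thesis by blast
qed

lemma finite_nodes: "finite (nodes p)"
proof (induction p)
  case (PNode k l es)
  have "finite (nodes (snd (es ! j)))" if "j < length es" for j
    using PNode[of "es ! j" "snd (es ! j)"] that by (simp add: prod_set_simps snds.intros)
  then show ?case by (auto simp: nodes_PNode)
qed

lemma node_dec_simps [simp]:
  "node_dec (PNode k l es) [] = k"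
  "j < length es \<Longrightarrow> node_dec (PNode k l es) (j # v) = node_dec (snd (es ! j)) v"
  by (simp_all add: node_dec_def)

text \<open>
  \<open>h m\<close> is a local change at a node depending on a parameter \<open>m\<close>; it is summed over all nodes and
  over the parameters \<open>m \<in> I k\<close> with weight \<open>c k m\<close>, where \<open>k\<close> is the decoration of the node.
\<close>

lemma sum_nodes_modify_eq_branch_deriv:
  fixes p :: "('n, 'k, 'i::finite) ptree"
  assumes h: "\<And>k l es. (\<Sum>m\<in>I k. c k m *\<^sub>R basis (forget (h m (PNode k l es))))
      = attach_all basis (mset (map (map_prod id forget) es)) (\<rho> k l)"
  shows "(\<Sum>u\<in>nodes p. \<Sum>m\<in>I (node_dec p u).
      c (node_dec p u) m *\<^sub>R basis (forget (modify (h m) u p))) = branch_deriv \<rho> (forget p)"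
proof (induction p)
  case (PNode k l es)
  let ?p = "PNode k l es"
  let ?F = "map_prod id forget :: _ \<Rightarrow> ('k, 'i) edge \<times> ('n, 'k, 'i) dtree"
  let ?E = "mset (map ?F es)"
  let ?g = "\<lambda>p u. \<Sum>m\<in>I (node_dec p u). c (node_dec p u) m *\<^sub>R basis (forget (modify (h m) u p))"
  let ?b = "\<lambda>(a, \<tau>). attach a (branch_deriv \<rho> \<tau>) (basis (Node k l (?E - {#(a, \<tau>)#})))"
  \<comment> \<open>A change at a node below child \<open>j\<close> alters that branch alone, so the
    result is the altered branch attached to the tree without the original one.\<close>
  have branch: "sum (?g ?p) ((#) j ` nodes (snd (es ! j))) = ?b (?F (es ! j))"
    if j: "j < length es" for j
  proof -
    obtain a q where q: "es ! j = (a, q)" by (cases "es ! j")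
    have "basis (forget (modify (h m) (j # v) ?p))
        = attach a (basis (forget (modify (h m) v q))) (basis (Node k l (?E - {#(a, forget q)#})))"
      for m v
      using j q mset_update[of j "map ?F es" "(a, forget (modify (h m) v q))"]
      by (simp add: map_update)
    then have "sum (?g ?p) ((#) j ` nodes q)
        = (\<Sum>v\<in>nodes q. attach a (?g q v) (basis (Node k l (?E - {#(a, forget q)#}))))"
      using j q
      by (simp add: sum.reindex linear_sum[OF linear_attach_left]
          linear_cmul[OF linear_attach_left])
    also have "\<dots> = attach a (branch_deriv \<rho> (forget q)) (basis (Node k l (?E - {#(a, forget q)#})))"
      using PNode[of "(a, q)" q] j q nth_mem[OF j]
      by (simp add: snds.intros flip: linear_sum[OF linear_attach_left] del: attach_linear)
    finally show ?thesis by (simp add: q)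
  qed
  have "sum (?g ?p) (nodes ?p)
      = ?g ?p [] + (\<Sum>j<length es. sum (?g ?p) ((#) j ` nodes (snd (es ! j))))"
    unfolding nodes_PNode
    by (subst sum.insert, simp add: finite_nodes, force, subst sum.UNION_disjoint)
      (auto simp: finite_nodes)
  also have "(\<Sum>j<length es. sum (?g ?p) ((#) j ` nodes (snd (es ! j))))
      = (\<Sum>y\<in>#?E. ?b y)"
    by (simp add: branch sum_mset_sum_list sum_list_sum_nth atLeast0LessThan
        flip: mset_map del: mset_map)
  also have "?g ?p [] = attach_all basis ?E (\<rho> k l)" by (simp add: h)
  finally show ?case by (simp add: branch_deriv.simps id_def)
qed

text \<open>Raising a decoration preserves the names of all nodes, so the fixed node set in
  \<open>up_on\<close> stays valid along the whole composition.\<close>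

lemma nodes_modify:
  assumes "\<And>q. nodes (f q) = nodes q"
  shows "nodes (modify f v p) = nodes p"
proof (induction v arbitrary: p)
  case (Cons j v)
  obtain k l es where p: "p = PNode k l es" by (cases p)
  have "nodes (snd (es[j := map_prod id (modify f v) (es ! j)] ! i)) = nodes (snd (es ! i))"
    if "j < length es" for i
    using that Cons by (cases "i = j") simp_all
  then show ?case by (simp add: p nodes_PNode)
qed (simp add: assms)

section \<open>Raising decorations as a composition of derivations\<close>

lemma up_on_eq_fold:
  fixes rs :: "'i::finite list"
  assumes "set rs = UNIV" "distinct rs"
  shows "up_on B k = fold (\<lambda>r F. (up_dir B r ^^ (k $ r)) \<circ> F) rs id"
proof -
  \<comment> \<open>Since the operators commute, the fold over the coordinates may follow any
    enumeration; list induction is then available.\<close>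
  interpret comp_fun_commute "\<lambda>r F. (up_dir B r ^^ (k $ r)) \<circ> F"
    by (rule comp_fun_commute_up_dir)
  show ?thesis
    using fold_set_fold_remdups[where xs = rs and y = id] assms by (simp add: up_on_def distinct_remdups_id)
qed

lemma up_on_0: "up_on B (0 :: nat ^ 'i::finite) = id"
proof -
  obtain rs :: "'i list" where rs: "set rs = UNIV" "distinct rs"
    using finite_distinct_list[OF finite[of "UNIV :: 'i set"]] by blast
  have "fold (\<lambda>r F. (up_dir B r ^^ ((0 :: nat ^ 'i) $ r)) \<circ> F) rs id = id"
    by (rule fold_invariant[where P = "\<lambda>F. F = id" and Q = "\<lambda>_. True"]) auto
  then show ?thesis by (simp add: up_on_eq_fold[OF rs])
qed

text \<open>The operator \<open>up (axis r 1)\<close>, see \<open>up_axis\<close>, written as a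
  derivation so that the Leibniz rules apply.\<close>

definition raise :: "'i \<Rightarrow> ('n, 'k, 'i::finite) T \<Rightarrow> ('n, 'k, 'i) T" where
  "raise r = lin_ext (branch_deriv (\<lambda>k l. basis (Node (k + axis r 1) l {#})))"

text \<open>Forgetting planarity intertwines \<open>up_dir B r\<close> with \<open>raise r\<close>
  as long as all planar trees in the support have node set \<open>B\<close>. Raising preserves this
  condition, which is therefore carried through the powers and the fold.\<close>

lemma forget_lin_up_on:
  fixes p :: "('n, 'k, 'i::finite) ptree" and rs :: "'i list"
  assumes rs: "set rs = UNIV" "distinct rs"
  shows "forget_lin (up_on (nodes p) k (basis p))
    = fold (\<lambda>r F. (raise r ^^ (k $ r)) \<circ> F) rs id (basis (forget p))"
proof -
  let ?D = "raise :: 'i \<Rightarrow> ('n, 'k, 'i) T \<Rightarrow> ('n, 'k, 'i) T"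
  \<comment> \<open>Raising has no parameter to sum over, hence the singleton index set with weight
    1.\<close>
  have tree: "forget_lin (up_dir (nodes p) r (basis p)) = ?D r (basis (forget p))"
    for r and p :: "('n, 'k, 'i) ptree"
    using sum_nodes_modify_eq_branch_deriv[where I = "\<lambda>_. {()}" and c = "\<lambda>_ _. 1"
        and h = "\<lambda>_ q. case q of PNode k l es \<Rightarrow> PNode (k + axis r 1) l es"
        and \<rho> = "\<lambda>k l. basis (Node (k + axis r 1) l {#})" and p = p]
    by (simp add: raise_def up_dir_def up_node_def linear_sum[OF linear_lin_ext] attach_all_basis)
  have nodes_up: "nodes (up_node r v q) = nodes q" for r v and q :: "('n, 'k, 'i) ptree"
    unfolding up_node_def
    by (rule nodes_modify) (auto simp: nodes_PNode split: ptree.splits)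
  have dir: "forget_lin (up_dir B r x) = ?D r (forget_lin x)
      \<and> (\<forall>q\<in>Poly_Mapping.keys (up_dir B r x). nodes q = B)"
    if "\<forall>q\<in>Poly_Mapping.keys x. nodes q = B" for B r and x :: "('n, 'k, 'i) ptree \<Rightarrow>\<^sub>0 real"
  proof
    have "forget_lin (up_dir B r x) = lin_ext (\<lambda>q. forget_lin (up_dir B r (basis q))) x"
      by (rule linear_eq_lin_ext[THEN fun_cong], rule linearI)
        (simp_all add: up_dir_def sum.distrib flip: scaleR_sum_right)
    also have "\<dots> = lin_ext (\<lambda>q. ?D r (basis (forget q))) x"
      using that tree by (intro lin_ext_cong) auto
    finally show "forget_lin (up_dir B r x) = ?D r (forget_lin x)"
      by (simp add: lin_ext_lin_ext raise_def)
    show "\<forall>q\<in>Poly_Mapping.keys (up_dir B r x). nodes q = B"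
    proof
      fix q assume "q \<in> Poly_Mapping.keys (up_dir B r x)"
      then obtain v q' where "q' \<in> Poly_Mapping.keys x" "q = up_node r v q'"
        by (auto simp: up_dir_def lin_ext_def in_keys_iff lookup_sum lookup_scaleR basis_def
            lookup_single when_def split: if_splits elim!: sum.not_neutral_contains_not_neutral)
      then show "nodes q = B" using that by (simp add: nodes_up)
    qed
  qed
  have pow: "forget_lin ((up_dir B r ^^ n) x) = (?D r ^^ n) (forget_lin x)
      \<and> (\<forall>q\<in>Poly_Mapping.keys ((up_dir B r ^^ n) x). nodes q = B)"
    if "\<forall>q\<in>Poly_Mapping.keys x. nodes q = B" for B r n and x :: "('n, 'k, 'i) ptree \<Rightarrow>\<^sub>0 real"
  proof (induction n)
    case (Suc n)
    then show ?case using dir[of "(up_dir B r ^^ n) x" B r] by simp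
  qed (use that in simp)
  have fold: "forget_lin (fold (\<lambda>r F. (up_dir B r ^^ (k $ r)) \<circ> F) xs F x)
      = fold (\<lambda>r F. (?D r ^^ (k $ r)) \<circ> F) xs F' (forget_lin x)"
    if "forget_lin (F x) = F' (forget_lin x)" "\<forall>q\<in>Poly_Mapping.keys (F x). nodes q = B"
    for B xs F F' and x :: "('n, 'k, 'i) ptree \<Rightarrow>\<^sub>0 real"
    using that
  proof (induction xs arbitrary: F F')
    case (Cons r xs)
    let ?F = "(up_dir B r ^^ (k $ r)) \<circ> F" and ?F' = "(?D r ^^ (k $ r)) \<circ> F'"
    have "forget_lin (?F x) = ?F' (forget_lin x)"
      "\<forall>q\<in>Poly_Mapping.keys (?F x). nodes q = B"
      using pow[OF Cons.prems(2)] Cons.prems(1) by simp_all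
    from Cons.IH[of ?F ?F', OF this] show ?case by simp
  qed simp
  have "forget_lin (id (basis p)) = id (forget_lin (basis p))"
    "\<forall>q\<in>Poly_Mapping.keys (id (basis p)). nodes q = nodes p"
    by (simp_all add: basis_def)
  from fold[of id "basis p" id "nodes p" rs, OF this] show ?thesis
    by (simp only: up_on_eq_fold[OF rs] lin_ext_basis)
qed

lemma up_eq_fold:
  fixes rs :: "'i::finite list"
  assumes rs: "set rs = UNIV" "distinct rs"
  shows "up k = fold (\<lambda>r F. (raise r ^^ (k $ r)) \<circ> F) rs (id :: ('n, 'k, 'i) T \<Rightarrow> _)"
proof
  fix x :: "('n, 'k, 'i) T"
  have pow: "linear (raise r ^^ n)" for r n
  proof (induction n)
    case (Suc n)
    show ?case
      using linear_compose[OF Suc linear_lin_ext] by (simp only: raise_def funpow.simps)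
  next
    case 0
    show ?case by (simp only: funpow.simps linear_id)
  qed
  have "linear (fold (\<lambda>r F. (raise r ^^ (k $ r)) \<circ> F) xs F)" if "linear F" for xs F
    using that
  proof (induction xs arbitrary: F)
    case (Cons r xs)
    show ?case using Cons.IH[OF linear_compose[OF Cons.prems pow]] by (simp only: fold.simps comp_apply)
  qed simp
  from this[OF linear_id, of rs] show "up k x = fold (\<lambda>r F. (raise r ^^ (k $ r)) \<circ> F) rs id x"
    by (rule linear_eqI_basis[rotated])
      (simp_all only: up_def linear_lin_ext lin_ext_basis forget_lin_up_on[OF rs] forget_planar)
qed

text \<open>Through this, commutation with every \<open>up k\<close> yields commutation with each
  \<open>raise r\<close>.\<close>

lemma up_axis: "up (axis r 1) = (raise r :: ('n, 'k, 'i::finite) T \<Rightarrow> _)"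
proof -
  obtain rs :: "'i list" where rs: "set rs = UNIV" "distinct rs"
    using finite_distinct_list[OF finite[of "UNIV :: 'i set"]] by blast
  have "fold (\<lambda>s F. (raise s ^^ (axis r 1 $ s)) \<circ> F) xs F
      = (if r \<in> set xs then raise r \<circ> F else F)"
    if "distinct xs" for xs and F :: "('n, 'k, 'i) T \<Rightarrow> ('n, 'k, 'i) T"
    using that by (induction xs arbitrary: F) (auto simp: axis_def)
  then show ?thesis by (simp add: up_eq_fold[OF rs] rs)
qed

section \<open>Grafting a single branch as a derivation\<close>

lemma mfact_nonzero [simp]: "mfact k \<noteq> 0"
  by (simp add: mfact_def)

lemma mfact_0 [simp]: "mfact 0 = 1"
  by (simp add: mfact_def)

text \<open>Grafting onto a single bare node; the weight is the binomial coefficient of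
  \<open>k\<close> over \<open>m\<close>. The test \<open>m \<le> snd a\<close> makes trees with a
  negative edge decoration vanish, since subtraction of naturals truncates.\<close>

definition graft_root ::
    "('k, 'i::finite) edge \<Rightarrow> ('n, 'k, 'i) T \<Rightarrow> nat ^ 'i \<Rightarrow> 'n option \<Rightarrow> ('n, 'k, 'i) T" where
  "graft_root a x k l = (\<Sum>m | m \<le> k.
     (if m \<le> snd a then mfact k / (mfact (k - m) * mfact m) else 0)
       *\<^sub>R attach (fst a, snd a - m) x (basis (Node (k - m) l {#})))"

text \<open>For one branch the families \<open>v\<close> and \<open>m\<close> are determined by
  their values at 0, so the sums over families become sums over a node and a multi-index.\<close>

lemma pgraft_single:
  "pgraft [(a, \<sigma>)] p = (\<Sum>u\<in>nodes p. \<Sum>m | m \<le> node_dec p u.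
     (if m \<le> snd a then mfact (node_dec p u) / (mfact (node_dec p u - m) * mfact m) else 0)
       *\<^sub>R basis (graft_step u m (a, \<sigma>) p))"
proof -
  let ?c = "\<lambda>u m. mfact (node_dec p u) / (mfact (node_dec p u - m) * mfact m)"
  have fibre: "{i. i < Suc 0 \<and> v i = u} = (if v 0 = u then {0} else {})"
    "{i. i = 0 \<and> v i = u} = (if v 0 = u then {0} else {})" for v :: "nat \<Rightarrow> nat list" and u
    by auto
  \<comment> \<open>Nothing is subtracted at a node other than \<open>v 0\<close>, so its factor is
    a quotient of equal factorials.\<close>
  have coeff: "graft_coeff (Suc 0) v m p = ?c (v 0) (m 0)" if "v 0 \<in> nodes p" for v m
  proof -
    have "graft_coeff (Suc 0) v m p = (\<Prod>u\<in>nodes p. if u = v 0 then ?c (v 0) (m 0) else 1)"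
      unfolding graft_coeff_def fibre by (rule prod.cong) auto
    then show ?thesis using that by (simp add: finite_nodes)
  qed
  have inner: "(\<Sum>m \<in> {m \<in> {..<Suc 0} \<rightarrow>\<^sub>E UNIV. \<forall>u\<in>nodes p.
        (\<Sum>i | i < Suc 0 \<and> v i = u. m i) \<le> node_dec p u}.
        graft_coeff (Suc 0) v m p *\<^sub>R
        (if \<forall>i<Suc 0. m i \<le> snd (fst ([(a, \<sigma>)] ! i)) then basis (graft_at [(a, \<sigma>)] v m p) else 0))
      = (\<Sum>m | m \<le> node_dec p (v 0). (if m \<le> snd a then ?c (v 0) m else 0)
          *\<^sub>R basis (graft_step (v 0) m (a, \<sigma>) p))"
    if "v 0 \<in> nodes p" for v
    by (rule sum.reindex_bij_witness[where j = "\<lambda>m. m 0" and i = "\<lambda>m. \<lambda>i\<in>{..<Suc 0}. m"])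
      (auto simp: fibre coeff that graft_at_def less_eq_vec_def PiE_iff extensional_def fun_eq_iff
        split: if_splits)
  let ?g = "\<lambda>u. \<Sum>m | m \<le> node_dec p u. (if m \<le> snd a then ?c u m else 0)
      *\<^sub>R basis (graft_step u m (a, \<sigma>) p)"
  have "length [(a, \<sigma>)] = Suc 0" by simp
  then have "pgraft [(a, \<sigma>)] p = (\<Sum>v \<in> {..<Suc 0} \<rightarrow>\<^sub>E nodes p. ?g (v 0))"
    unfolding pgraft_def Let_def by (simp only:) (rule sum.cong[OF refl], rule inner, auto)
  also have "\<dots> = (\<Sum>u\<in>nodes p. ?g u)"
    by (rule sum.reindex_bij_witness[where j = "\<lambda>v. v 0" and i = "\<lambda>v. \<lambda>i\<in>{..<Suc 0}. v"])
      (auto simp: PiE_iff extensional_def fun_eq_iff)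
  finally show ?thesis .
qed

lemma graft_single: "graft [(a, \<sigma>)] \<tau> = branch_deriv (graft_root a (basis \<sigma>)) \<tau>"
proof -
  obtain t q where a: "a = (t, q)" by (cases a)
  have "graft [(a, \<sigma>)] \<tau> = (\<Sum>u\<in>nodes (planar \<tau>). \<Sum>m | m \<le> node_dec (planar \<tau>) u.
     (if m \<le> snd a then mfact (node_dec (planar \<tau>) u)
        / (mfact (node_dec (planar \<tau>) u - m) * mfact m) else 0)
       *\<^sub>R basis (forget (graft_step u m (a, planar \<sigma>) (planar \<tau>))))"
    by (simp add: graft_def pgraft_single linear_sum[OF linear_lin_ext])
  also have "\<dots> = branch_deriv (graft_root a (basis \<sigma>)) (forget (planar \<tau>))"
    unfolding graft_step_def prod.case a
    by (rule sum_nodes_modify_eq_branch_deriv)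
      (simp add: graft_root_def linear_sum[OF linear_attach_all] linear_cmul[OF linear_attach_all]
        attach_all_attach attach_all_basis forget_planar)
  finally show ?thesis by (simp add: forget_planar)
qed

section \<open>Adjoints\<close>

lemma S_pos: "S \<tau> > 0"
proof (induction \<tau>)
  case (Node k l E)
  have "0 < (case y of (a, \<tau>) \<Rightarrow> S \<tau> ^ count E (a, \<tau>) * fact (count E (a, \<tau>)))" if "y \<in># E" for y
    using Node[OF that] by (cases y) (simp add: snds.intros)
  moreover have "mfact k > 0" by (simp add: mfact_def prod_pos)
  ultimately show ?case by (simp add: prod_pos)
qed

lemma inner_T_linear [simp]:
  "inner_T (x + x') y = inner_T x y + inner_T x' y"
  "inner_T (c *\<^sub>R x) y = c * inner_T x y"
  "inner_T 0 y = 0"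
  "inner_T x (y + y') = inner_T x y + inner_T x y'"
  "inner_T x (c *\<^sub>R y) = c * inner_T x y"
  "inner_T x 0 = 0"
  "inner_T (basis \<sigma>) (basis \<tau>) = (if \<sigma> = \<tau> then S \<tau> else 0)"
  by (simp_all add: inner_T_def)

lemma linear_inner_T: "linear (inner_T x)"
  by (rule linearI) simp_all

lemma inner_T_basis_right: "inner_T x (basis \<tau>) = Poly_Mapping.lookup x \<tau> * S \<tau>"
  by (induction x rule: poly_mapping_linear_induct)
    (simp_all add: lookup_add lookup_scaleR algebra_simps,
      simp add: basis_def lookup_single when_def)

lemma inner_T_eqI: "(\<And>\<tau>. inner_T x (basis \<tau>) = inner_T y (basis \<tau>)) \<Longrightarrow> x = y"
  by (rule poly_mapping_eqI) (metis S_pos inner_T_basis_right less_irrefl mult_right_cancel)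

lemma adj_eqI:
  assumes "is_adjoint A B"
  shows "adj A = B"
  unfolding adj_def
proof (rule the_equality[of "is_adjoint A", OF assms])
  show "B' = B" if "is_adjoint A B'" for B'
    using that assms by (intro ext inner_T_eqI) (simp add: is_adjoint_def)
qed

lemma is_adjointI:
  assumes "linear A" "linear B"
    and "\<And>\<sigma> \<tau>. inner_T (B (basis \<sigma>)) (basis \<tau>) = inner_T (basis \<sigma>) (A (basis \<tau>))"
  shows "is_adjoint A B"
  unfolding is_adjoint_def
proof (intro conjI allI)
  note lin = linear_add[OF assms(1)] linear_cmul[OF assms(1)]
    linear_add[OF assms(2)] linear_cmul[OF assms(2)]
  show "inner_T (B \<sigma>) \<tau> = inner_T \<sigma> (A \<tau>)" for \<sigma> \<tau>
  proof (induction \<sigma> rule: poly_mapping_linear_induct)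
    case (basis \<sigma>)
    show ?case
      by (induction \<tau> rule: poly_mapping_linear_induct) (simp_all add: lin assms(3))
  qed (simp_all add: lin)
qed (rule assms(2))

text \<open>The adjoint of \<open>attach a x\<close>, see \<open>inner_T_attach\<close>. The
  multiset sum removes equal branches once per occurrence, which is the multiplicity that the
  symmetry factor requires.\<close>

definition detach ::
    "('k, 'i::finite) edge \<Rightarrow> ('n, 'k, 'i) T \<Rightarrow> ('n, 'k, 'i) T \<Rightarrow> ('n, 'k, 'i) T" where
  "detach a x = lin_ext (\<lambda>\<tau>. case \<tau> of Node k l E \<Rightarrow>
     \<Sum>y\<in>#E. (if fst y = a then inner_T x (basis (snd y)) else 0)
       *\<^sub>R basis (Node k l (E - {#y#})))"

lemma detach_linear [simp]:
  "detach a x (A + B) = detach a x A + detach a x B"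
  "detach a x (c *\<^sub>R A) = c *\<^sub>R detach a x A"
  by (simp_all add: detach_def)

lemma detach_basis:
  "detach a x (basis (Node k l E)) =
    (\<Sum>y\<in>#E. (if fst y = a then inner_T x (basis (snd y)) else 0)
       *\<^sub>R basis (Node k l (E - {#y#})))"
  by (simp add: detach_def)

lemma detach_add:
  "detach a (x + y) A = detach a x A + detach a y A"
proof (induction A rule: poly_mapping_linear_induct)
  case (basis \<tau>)
  show ?case
    by (cases \<tau>)
      (auto simp: detach_basis scaleR_add_left if_distrib simp flip: sum_mset.distrib
        intro!: arg_cong[where f = sum_mset] image_mset_cong)
qed (simp_all add: algebra_simps)

lemma detach_scaleR:
  "detach a (c *\<^sub>R x) A = c *\<^sub>R detach a x A"
proof (induction A rule: poly_mapping_linear_induct)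
  case (basis \<tau>)
  show ?case
    by (cases \<tau>)
      (auto simp: detach_basis linear_sum_mset[OF linear_scaleR]
        intro!: arg_cong[where f = sum_mset] image_mset_cong)
qed (simp_all add: algebra_simps)

text \<open>The commutation relation of annihilation and creation operators: the branch removed is
  either the one just attached or another.\<close>

lemma detach_attach:
  "detach a x (attach b y A)
    = (if a = b then inner_T x y else 0) *\<^sub>R A + attach b y (detach a x A)"
proof (induction y rule: poly_mapping_linear_induct)
  case (basis \<sigma>)
  show ?case
  proof (induction A rule: poly_mapping_linear_induct)
    case (basis \<tau>)
    obtain k l E where \<tau>: "\<tau> = Node k l E" by (cases \<tau>)
    let ?f = "\<lambda>y F. (if fst y = a then inner_T x (basis (snd y)) else 0) *\<^sub>R basis (Node k l F)"
    have "(\<Sum>y\<in>#E. ?f y (add_mset (b, \<sigma>) (E - {#y#})))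
        = attach b (basis \<sigma>) (\<Sum>y\<in>#E. ?f y (E - {#y#}))"
      by (simp add: linear_sum_mset[OF linear_attach])
    then show ?case
      using sum_mset_add_mset_diff[of ?f "(b, \<sigma>)" E] by (simp add: \<tau> detach_basis)
  qed (simp_all add: algebra_simps)
qed (simp_all add: algebra_simps)

text \<open>One more copy of a branch of multiplicity \<beta> turns its factor S^\<beta> \<beta>!
  into S^(\<beta>+1) (\<beta>+1)!.\<close>

lemma S_add_mset:
  fixes E :: "(('k \<times> (nat ^ 'i::finite)) \<times> ('n, 'k, 'i) dtree) multiset"
  shows "S (Node k l (add_mset (a, \<sigma>) E)) = real (Suc (count E (a, \<sigma>))) * S \<sigma> * S (Node k l E)"
proof -
  let ?g = "\<lambda>F y. S (snd y) ^ count F y * fact (count F y)"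
  let ?z = "(a, \<sigma>)"
  \<comment> \<open>If \<open>?z\<close> does not occur in \<open>F\<close>, its factor is 1;
    inserting it gives products over the same index set before and after the addition.\<close>
  have S: "S (Node k l F) = mfact k * prod (?g F) (insert ?z (set_mset F))"
    for F :: "(('k \<times> (nat ^ 'i)) \<times> ('n, 'k, 'i) dtree) multiset"
    by (cases "?z \<in># F")
      (simp_all add: case_prod_unfold insert_absorb count_eq_zero_iff[THEN iffD2])
  have "prod (?g (add_mset ?z E)) (set_mset E - {?z}) = prod (?g E) (set_mset E - {?z})"
    by (rule prod.cong) auto
  then show ?thesis unfolding S by (simp add: prod.insert_remove)
qed

text \<open>On trees, detaching yields the multiplicity of the branch in the larger tree, which is
  the extra factor in \<open>S_add_mset\<close>.\<close>

lemma inner_T_attach: "inner_T (attach a x A) B = inner_T A (detach a x B)"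
proof (induction x rule: poly_mapping_linear_induct)
  case (basis \<sigma>)
  show ?case
  proof (induction A rule: poly_mapping_linear_induct)
    case (basis \<tau>)
    show ?case
    proof (induction B rule: poly_mapping_linear_induct)
      case (basis \<tau>')
      obtain k l E where \<tau>: "\<tau> = Node k l E" by (cases \<tau>)
      obtain k' l' E' where \<tau>': "\<tau>' = Node k' l' E'" by (cases \<tau>')
      let ?z = "(a, \<sigma>)"
      let ?c = "if Node k l E = Node k' l' (E' - {#?z#}) then S \<sigma> * S \<tau> else 0"
      have count: "(\<Sum>y\<in>#F. if ?z = y then c else 0) = count F ?z * c" for F and c :: real
        by (induction F) (auto simp: algebra_simps)
      have "inner_T (basis \<tau>) (detach a (basis \<sigma>) (basis \<tau>'))
          = (\<Sum>y\<in>#E'. if ?z = y then ?c else 0)"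
        unfolding \<tau>' detach_basis linear_sum_mset[OF linear_inner_T]
        by (rule arg_cong[where f = sum_mset], rule image_mset_cong) (auto simp: \<tau> simp del: S.simps)
      also have "\<dots> = count E' ?z * ?c"
        by (rule count)
      also have "\<dots> = inner_T (attach a (basis \<sigma>) (basis \<tau>)) (basis \<tau>')"
      proof (cases "?z \<in># E'")
        case True
        then obtain F where "E' = add_mset ?z F" by (metis mset_add)
        then show ?thesis by (auto simp: \<tau> \<tau>' S_add_mset simp del: S.simps)
      next
        case False
        then show ?thesis by (auto simp: \<tau> \<tau>' count_eq_zero_iff[THEN iffD2] simp del: S.simps)
      qed
      finally show ?case by simp
    qed simp_all
  qed (simp_all add: algebra_simps)
qed (simp_all add: algebra_simps detach_add detach_scaleR)

lemma detach_attach_all: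
  assumes "\<And>a x. detach a x A = 0"
  shows "detach a x (attach_all H E A) =
    (\<Sum>y\<in>#E. (if fst y = a then inner_T x (H (snd y)) else 0) *\<^sub>R attach_all H (E - {#y#}) A)"
proof (induction E)
  case (add z E)
  obtain b \<sigma> where z: "z = (b, \<sigma>)" by (cases z)
  let ?f = "\<lambda>y F. (if fst y = a then inner_T x (H (snd y)) else 0) *\<^sub>R attach_all H F A"
  have "(\<Sum>y\<in>#E. ?f y (add_mset (b, \<sigma>) (E - {#y#}))) = attach b (H \<sigma>) (\<Sum>y\<in>#E. ?f y (E - {#y#}))"
    by (simp add: linear_sum_mset[OF linear_attach])
  then show ?case
    using add sum_mset_add_mset_diff[of ?f "(b, \<sigma>)" E] by (simp add: z detach_attach)
qed (simp add: assms)

text \<open>Adjointness on branches lifts to trees. One branch of the left tree is moved to the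
  right as a \<open>detach\<close>, its weights are rewritten by the hypothesis, and
  \<open>detach_attach_all\<close> recognises the sum as a \<open>detach\<close> of the transformed
  right tree.\<close>

lemma inner_T_attach_all:
  assumes "\<And>a \<sigma> \<tau>. (a, \<sigma>) \<in># E \<Longrightarrow> inner_T (G \<sigma>) (basis \<tau>) = inner_T (basis \<sigma>) (H \<tau>)"
  shows "inner_T (attach_all G E (basis (Node k l {#}))) (basis (Node k' l' E'))
    = inner_T (basis (Node k l E)) (attach_all H E' (basis (Node k' l' {#})))"
  using assms
proof (induction E arbitrary: E')
  case empty
  show ?case
  proof (cases E')
    case (add z F)
    obtain a \<tau> where z: "z = (a, \<tau>)" by (cases z)
    \<comment> \<open>A tree with an attached branch is orthogonal to a bare root.\<close>
    have "inner_T (basis (Node k l {#})) (attach a x A) = 0" for x A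
    proof (induction A rule: poly_mapping_linear_induct)
      case (basis \<tau>)
      show ?case by (induction x rule: poly_mapping_linear_induct) (cases \<tau>, simp_all)+
    qed simp_all
    then show ?thesis by (simp add: add z)
  qed simp
next
  case (add z E)
  obtain a \<sigma> where z: "z = (a, \<sigma>)" by (cases z)
  have prem: "inner_T (G \<sigma>) (basis \<tau>) = inner_T (basis \<sigma>) (H \<tau>)" for \<tau>
    using add.prems[of a \<sigma>] by (simp add: z)
  have IH: "inner_T (attach_all G E (basis (Node k l {#}))) (basis (Node k' l' F))
      = inner_T (basis (Node k l E)) (attach_all H F (basis (Node k' l' {#})))" for F
  proof (rule add.IH)
    show "inner_T (G \<sigma>) (basis \<tau>) = inner_T (basis \<sigma>) (H \<tau>)" if "(b, \<sigma>) \<in># E" for b \<sigma> \<tau>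
      using that add.prems[of b \<sigma>] by simp
  qed
  have "inner_T (attach_all G (add_mset z E) (basis (Node k l {#}))) (basis (Node k' l' E'))
      = (\<Sum>y\<in>#E'. (if fst y = a then inner_T (basis \<sigma>) (H (snd y)) else 0)
          * inner_T (basis (Node k l E)) (attach_all H (E' - {#y#}) (basis (Node k' l' {#}))))"
    by (simp add: z inner_T_attach detach_basis linear_sum_mset[OF linear_inner_T] IH prem
        cong: if_cong)
  also have "\<dots> = inner_T (basis (Node k l E))
      (detach a (basis \<sigma>) (attach_all H E' (basis (Node k' l' {#}))))"
    by (simp add: detach_attach_all detach_basis linear_sum_mset[OF linear_inner_T])
  also have "\<dots> = inner_T (basis (Node k l (add_mset z E)))
      (attach_all H E' (basis (Node k' l' {#})))"
    by (simp add: z flip: inner_T_attach)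
  finally show ?case .
qed

section \<open>The map \<open>M\<degree>\<close>\<close>

lemma prodT_linear [simp]:
  "prodT (x + x') y = prodT x y + prodT x' y"
  "prodT (c *\<^sub>R x) y = c *\<^sub>R prodT x y"
  "prodT 0 y = 0"
  "prodT x (y + y') = prodT x y + prodT x y'"
  "prodT x (c *\<^sub>R y) = c *\<^sub>R prodT x y"
  "prodT x 0 = 0"
  "prodT (basis \<sigma>) (basis \<tau>) = tree_prod \<sigma> \<tau>"
  by (simp_all add: prodT_def)

lemma tree_prod_commute: "tree_prod \<sigma> \<tau> = tree_prod \<tau> \<sigma>"
proof (cases "(\<sigma>, \<tau>)" rule: tree_prod.cases)
  case (1 k E k' l' E')
  then show ?thesis by (cases l') (simp_all add: ac_simps)
qed (simp_all add: ac_simps)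

lemma prodT_commute: "prodT x y = prodT y x"
proof (induction x rule: poly_mapping_linear_induct)
  case (basis \<sigma>)
  show ?case
    by (induction y rule: poly_mapping_linear_induct) (simp_all add: tree_prod_commute[of \<sigma>])
qed simp_all

lemma prodT_attach: "prodT (attach a x A) B = attach a x (prodT A B)"
proof (induction A rule: poly_mapping_linear_induct)
  case (basis \<sigma>)
  show ?case
  proof (induction B rule: poly_mapping_linear_induct)
    case (basis \<tau>)
    show ?case
      by (induction x rule: poly_mapping_linear_induct)
        (simp_all, cases "(\<sigma>, \<tau>)" rule: tree_prod.cases, simp_all)
  qed simp_all
qed simp_all

lemma prodT_attach_all: "prodT (attach_all G E A) B = attach_all G E (prodT A B)"
  by (induction E) (auto simp: prodT_attach)

lemma attach_all_plus: "attach_all G (E + F) A = attach_all G E (attach_all G F A)"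
  by (induction E) auto

lemma IT_eq_attach: "\<I>T a x = attach a x (basis (Node 0 None {#}))"
  by (induction x rule: poly_mapping_linear_induct) (simp_all add: \<I>_def)

lemma prodT_IT: "prodT A (\<I>T a x) = attach a x A"
proof -
  have "prodT (basis (Node 0 None {#})) A = A"
  proof (induction A rule: poly_mapping_linear_induct)
    case (basis \<tau>)
    then show ?case by (cases \<tau>) simp
  qed simp_all
  then show ?thesis
    unfolding IT_eq_attach by (simp add: prodT_commute[of A] prodT_attach)
qed

text \<open>A tree is the product of \<open>X k\<close>, possibly a noise, and planted trees, so
  multiplicativity and the values on these factors amount to a recursion at the root.\<close>

lemma is_Mcirc_iff:
  "is_Mcirc R F \<longleftrightarrow> linear F \<and>
     (\<forall>k l E. F (basis (Node k l E)) = attach_all (\<lambda>\<tau>. F (R (basis \<tau>))) E (basis (Node k l {#})))"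
  (is "_ \<longleftrightarrow> linear F \<and> ?rec") if "linear R"
proof
  assume F: "is_Mcirc R F"
  then have lin: "linear F" by (simp add: is_Mcirc_def)
  have prod: "F (tree_prod \<sigma> \<tau>) = prodT (F (basis \<sigma>)) (F (basis \<tau>))"
    if "root_noise \<sigma> = None \<or> root_noise \<tau> = None" for \<sigma> \<tau>
    using F that unfolding is_Mcirc_def prodT_linear(7) by blast
  have single: "F (basis (Node k l {#})) = basis (Node k l {#})" for k l
  proof (cases l)
    case None
    then show ?thesis using F by (simp add: is_Mcirc_def X_def)
  next
    case (Some l')
    then show ?thesis
      using F prod[of "X k" "\<zeta> l'"] by (simp add: is_Mcirc_def X_def \<zeta>_def)
  qed
  have "F (basis (Node k l E)) = attach_all (\<lambda>\<tau>. F (R (basis \<tau>))) E (basis (Node k l {#}))" for k l E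
  proof (induction E)
    case (add y E)
    obtain a \<tau> where y: "y = (a, \<tau>)" by (cases y)
    have "tree_prod (Node k l E) (\<I> a \<tau>) = basis (Node k l (add_mset y E))"
      by (cases l) (simp_all add: \<I>_def y)
    then have "F (basis (Node k l (add_mset y E))) = prodT (F (basis (Node k l E))) (F (basis (\<I> a \<tau>)))"
      using prod[of "Node k l E" "\<I> a \<tau>"] by (simp add: \<I>_def)
    also have "F (basis (\<I> a \<tau>)) = \<I>T a (F (R (basis \<tau>)))"
      using F unfolding is_Mcirc_def by (metis lin_ext_basis)
    finally show ?case by (simp add: prodT_IT y add)
  qed (simp add: single)
  with lin show "linear F \<and> ?rec" by blast
next
  assume F: "linear F \<and> ?rec"
  then have lin: "linear F" and rec: "F (basis (Node k l E))
      = attach_all (\<lambda>\<tau>. F (R (basis \<tau>))) E (basis (Node k l {#}))" for k l E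
    by auto
  show "is_Mcirc R F"
    unfolding is_Mcirc_def
  proof (intro conjI allI impI)
    fix \<sigma> \<tau> :: "('a, 'b, 'c) dtree"
    assume noise: "root_noise \<sigma> = None \<or> root_noise \<tau> = None"
    obtain k l E where \<sigma>: "\<sigma> = Node k l E" by (cases \<sigma>)
    obtain k' l' E' where \<tau>: "\<tau> = Node k' l' E'" by (cases \<tau>)
    show "F (prodT (basis \<sigma>) (basis \<tau>)) = prodT (F (basis \<sigma>)) (F (basis \<tau>))"
      using noise
      by (cases l; cases l')
        (simp_all add: \<sigma> \<tau> rec prodT_attach_all attach_all_plus
          prodT_commute[of "basis _" "attach_all _ _ _"] add.commute[of k'])
  next
    fix a x
    show "F (\<I>T a x) = \<I>T a (F (R x))"
      unfolding IT_eq_attach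
      by (induction x rule: poly_mapping_linear_induct)
        (simp_all add: rec linear_add[OF lin] linear_cmul[OF lin]
          linear_add[OF that] linear_cmul[OF that])
  qed (simp_all add: lin X_def \<zeta>_def rec)
qed

context
  fixes R :: "('n, 'k, 'i::finite) T \<Rightarrow> ('n, 'k, 'i) T"
  assumes lin: "linear R"
    and noise: "\<And>\<tau> \<tau>'. \<tau>' \<in> Poly_Mapping.keys (R (basis \<tau>))
      \<Longrightarrow> \<tau>' = \<tau> \<or> noise_count \<tau>' < noise_count \<tau>"
begin

text \<open>Termination of the recursion for \<open>M\<degree>\<close>: a tree in
  \<open>R \<tau>\<close> may be larger than \<open>\<tau>\<close>, but then it has fewer noises;
  otherwise it is the branch \<open>\<tau>\<close> itself, which is smaller and has no more noises
  than the whole tree.\<close>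

lemma branch_descent:
  assumes "(a, \<tau>) \<in># E" "\<tau>' \<in> Poly_Mapping.keys (R (basis \<tau>))"
  shows "(\<tau>', Node k l E) \<in> noise_count <*mlex*> Wellfounded.measure size"
proof -
  have "noise_count \<tau> \<le> noise_count (Node k l E)"
    using assms(1) by (auto dest!: multi_member_split)
  then show ?thesis
    using noise[OF assms(2)] size_branch_less[OF assms(1)] by (fastforce simp: mlex_prod_def)
qed

function Mcirc_tree :: "('n, 'k, 'i) dtree \<Rightarrow> ('n, 'k, 'i) T" where
  "Mcirc_tree (Node k l E)
    = attach_all (\<lambda>\<tau>. lin_ext Mcirc_tree (R (basis \<tau>))) E (basis (Node k l {#}))"
  by pat_completeness auto
termination
  by (relation "noise_count <*mlex*> Wellfounded.measure size")
    (auto intro: wf_mlex branch_descent)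

text \<open>\<open>Mcirc\<close> is a definite description, so existence and uniqueness are both
  required. \<open>Mcirc_tree\<close> gives the first, and its induction rule shows that every
  solution agrees with it.\<close>

lemma is_Mcirc_Mcirc: "is_Mcirc R (Mcirc R)"
  unfolding Mcirc_def
proof (rule theI[of "is_Mcirc R"])
  show "is_Mcirc R (lin_ext Mcirc_tree)"
    by (simp add: is_Mcirc_iff[OF lin] linear_lin_ext)
  show "F = lin_ext Mcirc_tree" if "is_Mcirc R F" for F
  proof -
    have F: "linear F" "F (basis (Node k l E))
        = attach_all (\<lambda>\<tau>. F (R (basis \<tau>))) E (basis (Node k l {#}))" for k l E
      using that by (auto simp: is_Mcirc_iff[OF lin])
    have "F (basis \<tau>) = Mcirc_tree \<tau>" for \<tau>
    proof (induction \<tau> rule: Mcirc_tree.induct)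
      case (1 k l E)
      have "F (R (basis \<tau>)) = lin_ext Mcirc_tree (R (basis \<tau>))" if "(a, \<tau>) \<in># E" for a \<tau>
        using 1[OF that] by (subst linear_eq_lin_ext[OF F(1)]) (rule lin_ext_cong, auto)
      then show ?case by (auto simp: F(2) intro: attach_all_cong)
    qed
    then show ?thesis by (subst linear_eq_lin_ext[OF F(1)]) simp
  qed
qed

end

section \<open>The adjoint of \<open>M\<close>\<close>

text \<open>
  For \<open>B = R\<^sup>*\<close> this is the adjoint of \<open>M\<degree>\<close>.
\<close>

function Mcirc_adj ::
    "(('n, 'k, 'i::finite) T \<Rightarrow> ('n, 'k, 'i) T) \<Rightarrow> ('n, 'k, 'i) dtree \<Rightarrow> ('n, 'k, 'i) T" where
  "Mcirc_adj B (Node k l E) = attach_all (\<lambda>\<tau>. B (Mcirc_adj B \<tau>)) E (basis (Node k l {#}))"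
  by pat_completeness auto
termination
  by (relation "Wellfounded.measure (\<lambda>(B, \<tau>). size \<tau>)")
    (auto simp: size_branch_less simp del: dtree.size)

text \<open>Taking adjoints reverses a composition, so it suffices that \<open>Mcirc_adj B\<close>
  is adjoint to \<open>M\<degree>\<close>. The two recursions match: \<open>B\<close> after
  \<open>Mcirc_adj B\<close> on the branches of one tree is adjoint to \<open>Mcirc R\<close> after
  \<open>R\<close> on those of the other.\<close>

lemma is_adjoint_M:
  assumes R: "linear R" "is_adjoint R B" and M: "is_Mcirc R (Mcirc R)"
  shows "is_adjoint (M R) (B \<circ> lin_ext (Mcirc_adj B))"
proof (rule is_adjointI)
  have lin: "linear (Mcirc R)" and rec: "Mcirc R (basis (Node k l E))
      = attach_all (\<lambda>\<tau>. Mcirc R (R (basis \<tau>))) E (basis (Node k l {#}))" for k l E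
    using M by (auto simp: is_Mcirc_iff[OF R(1)])
  have B: "linear B" "\<And>x y. inner_T (B x) y = inner_T x (R y)"
    using R(2) by (auto simp: is_adjoint_def)
  show "linear (M R)" unfolding M_def by (rule linear_compose[OF R(1) lin])
  show "linear (B \<circ> lin_ext (Mcirc_adj B))" by (rule linear_compose[OF linear_lin_ext B(1)])
  \<comment> \<open>The second argument is not restricted to trees, as the induction hypothesis for
    a branch is applied to \<open>R (basis \<tau>)\<close>.\<close>
  have "inner_T (Mcirc_adj B \<sigma>) x = inner_T (basis \<sigma>) (Mcirc R x)" for \<sigma> x
  proof (induction \<sigma> arbitrary: x rule: measure_induct_rule[where f = size])
    case (less \<sigma>)
    obtain k l E where \<sigma>: "\<sigma> = Node k l E" by (cases \<sigma>)
    have IH: "inner_T (Mcirc_adj B \<sigma>') x = inner_T (basis \<sigma>') (Mcirc R x)"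
      if "(a, \<sigma>') \<in># E" for a \<sigma>' x
      using less size_branch_less[OF that] \<sigma> by blast
    show ?case
    proof (induction x rule: poly_mapping_linear_induct)
      case (basis \<tau>)
      obtain k' l' E' where \<tau>: "\<tau> = Node k' l' E'" by (cases \<tau>)
      show ?case
        unfolding \<sigma> \<tau> Mcirc_adj.simps rec
        by (rule inner_T_attach_all) (simp add: B(2) IH)
    qed (simp_all add: linear_add[OF lin] linear_cmul[OF lin])
  qed
  then show "inner_T ((B \<circ> lin_ext (Mcirc_adj B)) (basis \<sigma>)) (basis \<tau>)
      = inner_T (basis \<sigma>) (M R (basis \<tau>))" for \<sigma> \<tau>
    by (simp add: B(2) M_def)
qed

lemma Mcirc_adj_attach:
  assumes "linear B"
  shows "lin_ext (Mcirc_adj B) (attach a x A)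
    = attach a (B (lin_ext (Mcirc_adj B) x)) (lin_ext (Mcirc_adj B) A)"
proof (induction x rule: poly_mapping_linear_induct)
  case (basis \<sigma>)
  show ?case
  proof (induction A rule: poly_mapping_linear_induct)
    case (basis \<tau>)
    show ?case by (cases \<tau>) simp
  qed simp_all
qed (simp_all add: linear_add[OF assms] linear_cmul[OF assms])

text \<open>
  \<open>M\<degree>\<^sup>*\<close> satisfies a Leibniz rule over the branches at the root, as do grafting and raising; so
  the commutation of \<open>B\<close> with \<open>\<rho>'\<close> propagates from the branches to the whole tree.
\<close>

lemma Mcirc_adj_branch_deriv:
  assumes B: "linear B"
    and commute: "\<And>x. B (lin_ext (branch_deriv \<rho>') x) = lin_ext (branch_deriv \<rho>') (B x)"
    and root: "\<And>k l. lin_ext (Mcirc_adj B) (\<rho> k l) = \<rho>' k l"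
  shows "lin_ext (Mcirc_adj B) (lin_ext (branch_deriv \<rho>) x)
    = lin_ext (branch_deriv \<rho>') (lin_ext (Mcirc_adj B) x)"
proof -
  let ?N = "lin_ext (Mcirc_adj B)"
  let ?G = "\<lambda>\<tau>. B (Mcirc_adj B \<tau>)"
  have all: "?N (attach_all basis E A) = attach_all ?G E (?N A)" for E A
    by (induction E) (auto simp: Mcirc_adj_attach[OF B])
  have "?N (branch_deriv \<rho> \<tau>) = lin_ext (branch_deriv \<rho>') (Mcirc_adj B \<tau>)" for \<tau>
  proof (induction \<tau> rule: measure_induct_rule[where f = size])
    case (less \<tau>)
    obtain k l E where \<tau>: "\<tau> = Node k l E" by (cases \<tau>)
    let ?A = "basis (Node k l {#})"
    have "attach (fst y) (B (?N (branch_deriv \<rho> (snd y)))) (attach_all ?G (E - {#y#}) ?A)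
        = attach (fst y) (lin_ext (branch_deriv \<rho>') (?G (snd y))) (attach_all ?G (E - {#y#}) ?A)"
      if "y \<in># E" for y
    proof -
      have "size (snd y) < size \<tau>"
        using that size_branch_less[of "fst y" "snd y" E k l] by (simp add: \<tau> del: dtree.size)
      then show ?thesis by (simp add: less commute)
    qed
    then show ?case
      by (simp add: \<tau> branch_deriv.simps all root linear_sum_mset[OF linear_lin_ext]
          Mcirc_adj_attach[OF B] branch_deriv_attach_all case_prod_unfold attach_all_basis
          cong: image_mset_cong)
  qed
  then show ?thesis by (simp add: lin_ext_lin_ext)
qed

section \<open>Grafting and the product \<open>\<star>\<close> on linear combinations\<close>

lemma graft_root_linear:
  "graft_root a (x + y) k l = graft_root a x k l + graft_root a y k l"
  "graft_root a (c *\<^sub>R x) k l = c *\<^sub>R graft_root a x k l"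
  by (simp_all add: graft_root_def sum.distrib scaleR_add_right scaleR_sum_right mult.commute)

text \<open>The grafted tree enters \<open>branch_deriv\<close> through \<open>\<rho>\<close>, so
  linearity in \<open>\<rho>\<close> is what extends \<open>graft_single\<close> to linear
  combinations on the left.\<close>

lemma branch_deriv_linear:
  fixes \<rho> :: "nat ^ 'i::finite \<Rightarrow> 'n option \<Rightarrow> ('n, 'k, 'i) T"
  shows "branch_deriv (\<lambda>k l. \<rho> k l + \<rho>' k l) \<tau> = branch_deriv \<rho> \<tau> + branch_deriv \<rho>' \<tau>"
    and "branch_deriv (\<lambda>k l. c *\<^sub>R \<rho> k l) \<tau> = c *\<^sub>R branch_deriv \<rho> \<tau>"
proof (induction \<tau> rule: measure_induct_rule[where f = size])
  case (less \<tau>)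
  obtain k l E where \<tau>: "\<tau> = Node k l E" by (cases \<tau>)
  have size: "size (snd y) < size \<tau>" if "y \<in># E" for y
    using that size_branch_less[of "fst y" "snd y" E k l] by (simp add: \<tau> del: dtree.size)
  {
    case 1
    then show ?case
      by (simp add: \<tau> branch_deriv.simps case_prod_unfold linear_add[OF linear_attach_all]
          less(1)[OF size, unfolded \<tau>] sum_mset.distrib algebra_simps cong: image_mset_cong)
  next
    case 2
    then show ?case
      by (simp add: \<tau> branch_deriv.simps case_prod_unfold linear_cmul[OF linear_attach_all]
          less(2)[OF size, unfolded \<tau>] linear_sum_mset[OF linear_scaleR] algebra_simps
          cong: image_mset_cong)
  }
qed

lemma graft1_eq: "x \<curvearrowright>\<^bsub>a\<^esub> y = lin_ext (branch_deriv (graft_root a x)) y"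
proof (induction y rule: poly_mapping_linear_induct)
  case (basis \<tau>)
  show ?case
    by (induction x rule: poly_mapping_linear_induct)
      (simp_all add: graft1_def graft_single branch_deriv_linear graft_root_linear[abs_def])
qed (simp_all add: graft1_def)

lemma star_I: "basis (\<I> a \<sigma>) \<star> y = basis \<sigma> \<curvearrowright>\<^bsub>a\<^esub> y"
proof -
  \<comment> \<open>A singleton multiset has one enumeration only, which determines the choice made
    in \<open>star_tree\<close>.\<close>
  have "(SOME fs. mset fs = {#(a, \<sigma>)#}) = [(a, \<sigma>)]" by (simp add: mset_single_iff)
  then have "star_tree (\<I> a \<sigma>) = graft [(a, \<sigma>)]"
    by (intro ext) (simp add: \<I>_def up_on_0 graft_def)
  then show ?thesis by (simp add: star_def graft1_def bilin_ext_def)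
qed

lemma pgraft_Nil: "pgraft [] p = basis p"
proof -
  have "graft_coeff 0 v m p = 1" for v m by (simp add: graft_coeff_def)
  moreover have "0 \<le> node_dec p u" for u by (simp add: less_eq_vec_def)
  ultimately show ?thesis by (simp add: pgraft_def graft_at_def)
qed

lemma star_X: "basis (X k) \<star> y = up k y"
  by (simp add: star_def bilin_ext_def X_def pgraft_Nil up_def cong: lin_ext_cong)

theorem theorem6:
  fixes s :: "nat ^ 'i::finite"
    and dn :: "'n::finite \<Rightarrow> real"
    and dk :: "'k::finite \<Rightarrow> real"
    and R :: "('n, 'k, 'i) T \<Rightarrow> ('n, 'k, 'i) T"
  assumes "2 \<le> CARD('i)"
    and "\<forall>r. 0 < s $ r"
    and "\<forall>l. dn l < 0"
    and "\<forall>t. 0 < dk t"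
    and "strong_preparation_map s dn dk R"
  shows "is_adjoint (M R) (adj (M R))
    \<and> good_multi_pre_Lie_morphism (adj (M R))
    \<and> (\<forall>l. adj (M R) (basis (\<zeta> l)) = adj R (basis (\<zeta> l)))"
proof -
  let ?B = "adj R"
  let ?N = "lin_ext (Mcirc_adj ?B)"
  have lin_R: "linear R"
    using assms(5) by (simp add: strong_preparation_map_def preparation_map_def)
  have noise: "\<tau>' = \<tau> \<or> noise_count \<tau>' < noise_count \<tau>"
    if key: "\<tau>' \<in> Poly_Mapping.keys (R (basis \<tau>))" for \<tau> \<tau>'
  proof -
    obtain A c where A: "\<forall>\<tau>'\<in>A. noise_count \<tau>' < noise_count \<tau>"
      and R: "R (basis \<tau>) = basis \<tau> + (\<Sum>\<tau>'\<in>A. c \<tau>' *\<^sub>R basis \<tau>')"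
      using assms(5) unfolding strong_preparation_map_def preparation_map_def by meson
    have "\<tau>' = \<tau> \<or> \<tau>' \<in> A"
      using key by (auto simp: R in_keys_iff lookup_add lookup_sum lookup_scaleR lookup_basis
          split: if_splits elim!: sum.not_neutral_contains_not_neutral)
    then show ?thesis using A by blast
  qed
  obtain B where "is_adjoint R B"
    using assms(5) by (auto simp: strong_preparation_map_def)
  \<comment> \<open>Adjoints are unique, so the one assumed to exist is
    \<open>adj R\<close>.\<close>
  then have adj_R: "is_adjoint R ?B" using adj_eqI by metis
  then have lin_B: "linear ?B" by (simp add: is_adjoint_def)
  have adj_M: "is_adjoint (M R) (?B \<circ> ?N)"
    using is_adjoint_M[OF lin_R adj_R is_Mcirc_Mcirc] lin_R noise by blast
  have star: "?B (basis \<sigma> \<star> y) = basis \<sigma> \<star> ?B y" if "root_noise \<sigma> = None" for \<sigma> y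
    using assms(5) that by (simp add: strong_preparation_map_def)
  have B_graft: "?B (x \<curvearrowright>\<^bsub>a\<^esub> y) = x \<curvearrowright>\<^bsub>a\<^esub> ?B y" for x a y
  proof (induction x rule: poly_mapping_linear_induct)
    case (basis \<sigma>)
    then show ?case using star[of "\<I> a \<sigma>" y] by (simp add: star_I) (simp add: \<I>_def)
  qed (simp_all add: graft1_def linear_add[OF lin_B] linear_cmul[OF lin_B])
  have B_up: "?B (up k y) = up k (?B y)" for k y
    using star[of "X k" y] by (simp add: star_X) (simp add: X_def)
  \<comment> \<open>Both sides are derivations, with grafted elements \<open>x\<close> and
    \<open>?B (?N x)\<close>: on a bare node, \<open>?N\<close> maps the new branch \<open>x\<close>
    to \<open>?B (?N x)\<close>. The commutation required of \<open>?B\<close> is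
    \<open>B_graft\<close>.\<close>
  have N_graft: "?N (x \<curvearrowright>\<^bsub>a\<^esub> y) = ?B (?N x) \<curvearrowright>\<^bsub>a\<^esub> ?N y" for x a y
    unfolding graft1_eq
  proof (rule Mcirc_adj_branch_deriv[OF lin_B])
    show "?N (graft_root a x k l) = graft_root a (?B (?N x)) k l" for k l
      by (simp add: graft_root_def linear_sum[OF linear_lin_ext] Mcirc_adj_attach[OF lin_B])
  qed (simp only: B_graft flip: graft1_eq)
  \<comment> \<open>\<open>?N\<close> fixes bare nodes, so \<open>\<rho>\<close> and
    \<open>\<rho>'\<close> coincide here; the commutation required of \<open>?B\<close> is
    \<open>B_up\<close> at \<open>axis r 1\<close>.\<close>
  have N_raise: "?N (raise r y) = raise r (?N y)" for r y
    unfolding raise_def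
    by (rule Mcirc_adj_branch_deriv[OF lin_B])
      (simp_all only: lin_ext_basis Mcirc_adj.simps attach_all_empty B_up flip: raise_def up_axis)
  have N_up: "?N (up k y) = up k (?N y)" for k y
  proof -
    obtain rs :: "'i list" where rs: "set rs = UNIV" "distinct rs"
      using finite_distinct_list[OF finite[of "UNIV :: 'i set"]] by blast
    have pow: "?N ((raise r ^^ n) z) = (raise r ^^ n) (?N z)" for r n z
      by (induction n) (simp_all add: N_raise)
    have "?N (fold (\<lambda>r F. (raise r ^^ (k $ r)) \<circ> F) xs F y)
        = fold (\<lambda>r F. (raise r ^^ (k $ r)) \<circ> F) xs F (?N y)"
      if "?N (F y) = F (?N y)" for xs F
      using that by (induction xs arbitrary: F) (simp_all add: pow)
    then show ?thesis by (simp add: up_eq_fold[OF rs])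
  qed
  \<comment> \<open>\<open>N_graft\<close> puts \<open>?B (?N x)\<close> on the left but only
    \<open>?N y\<close> on the right; the remaining outer \<open>?B\<close> passes to the right
    factor by \<open>B_graft\<close>.\<close>
  have "good_multi_pre_Lie_morphism (?B \<circ> ?N)"
    unfolding good_multi_pre_Lie_morphism_def
    by (simp add: linear_compose[OF linear_lin_ext lin_B] N_graft B_graft N_up B_up fun_eq_iff)
  \<comment> \<open>A noise has no branches, so \<open>?N\<close> fixes it and only
    \<open>?B\<close> acts.\<close>
  then show ?thesis
    using adj_M adj_eqI[OF adj_M] by (simp add: \<zeta>_def)
qed

end
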